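(* For any $\boldsymbol{\ell}=(\ell_1,\ell_2,\ell_3)\in\mathbb{N}_0^3$ and $\boldsymbol{\alpha}=(\alpha_0,\alpha_1,\alpha_2,\alpha_3)\in[-1,+\infty)^4$, the generalized Koornwinder polynomials satisfy, for $\hat{\boldsymbol x}=(\hat x_1,\hat x_2,\hat x_3)^{\mathsf T}\in\hat{\mathcal T}$, \begin{align*} \hat x_1\,\mathcal{J}_{\boldsymbol{\ell}}^{\boldsymbol{\alpha}}(\hat{\boldsymbol x})&=\sum_{p=-1}^1\sum_{q=-1}^1\sum_{r=-1}^1\mathscr{C}_{p,q,r}(\boldsymbol{\ell},\boldsymbol{\alpha})\,\mathcal{J}^{\boldsymbol{\alpha}}_{\boldsymbol{\ell}-(p,\,q-p,\,r-q)}(\hat{\boldsymbol x}),\\ \hat x_2\,\mathcal{J}_{\boldsymbol{\ell}}^{\boldsymbol{\alpha}}(\hat{\boldsymbol x})&=\sum_{q=-1}^1\sum_{r=-1}^1\mathscr{C}_{q,r}(\boldsymbol{\ell},\boldsymbol{\alpha})\,\mathcal{J}^{\boldsymbol{\alpha}}_{\boldsymbol{\ell}-(0,\,q,\,r-q)}(\hat{\boldsymbol x}),\\ \hat x_3\,\mathcal{J}_{\boldsymbol{\ell}}^{\boldsymbol{\alpha}}(\hat{\boldsymbol x})&=\sum_{r=-1}^1\mathscr{C}_{r}(\boldsymbol{\ell},\boldsymbol{\alpha})\,\mathcal{J}^{\boldsymbol{\alpha}}_{\boldsymbol{\ell}-(0,\,0,\,r)}(\hat{\boldsymbol x}), \end{align*}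 with the explicit coefficients $\mathscr{C}_{p,q,r},\mathscr{C}_{q,r},\mathscr{C}_r$ given in the context. Equivalently, for any $m\in\mathbb{N}_0$ (with $\boldsymbol{\alpha}$ fixed) there exist unique matrices $A_m\in\mathbb{R}^{3r_m\times r_{m+1}}$, $B_m(\hat{\boldsymbol x})\in\mathbb{R}^{3r_m\times r_m}$, $C_m\in\mathbb{R}^{3r_m\times r_{m-1}}$ of the block form described below, whose blocks $E,F,G,U,V,W,X,Y,Z$ are real matrices independent of $\hat{\boldsymbol x}$, such that $$A_m\mathbf{P}^{m+1}+B_m(\hat{\boldsymbol x})\mathbf{P}^m+C_m\mathbf{P}^{m-1}=\boldsymbol 0\qquad\text{for all }\hat{\boldsymbol x}\in\hat{\mathcal T}.$$ Block form. Write $$A_m=\begin{pmatrix} A_m^1 \\ A_m^2 \\ A_m^3 \end{pmatrix},\qquad B_m(\hat{\boldsymbol x})=\begin{pmatrix} \tilde B_m^1 \\ \tilde B_m^2 \\ \tilde B_m^3 \end{pmatrix},\qquad C_m=\begin{pmatrix} C_m^1 \\ C_m^2 \\ C_m^3 \end{pmatrix},$$ each of the three pieces having $r_m$ rows. Partition the rows of each piece into block rows $k=0,\dots,m$ of height $m+1-k$. Partition the columns into block columns $j$ of width $m+2-j$, $0\le j\le m+1$, for $A_m^i$; of width $m+1-j$, $0\le j\le m$, for $\tilde B_m^i$; and of width $m-j$, $0\le j\le m-1$, for $C_m^i$. All blocks not listed are zero. (1) $A_m^1$ has blocks $E^1_k$ at $(k,k)$ and $F^1_k$ at $(k,k+1)$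 for $0\le k\le m$, and $G^1_k$ at $(k,k-1)$ for $1\le k\le m$. For $i=2,3$, $A_m^i$ has blocks $E^i_k$ at $(k,k)$, $0\le k\le m$. (2) $\tilde B_m^1$ has blocks $V^1_k-\hat x_1I$ at $(k,k)$ for $0\le k\le m$, $W^1_k$ at $(k,k+1)$ for $0\le k\le m-1$, and $U^1_k$ at $(k,k-1)$ for $1\le k\le m$. For $i=2,3$, $\tilde B_m^i$ has blocks $V^i_k-\hat x_iI$ at $(k,k)$, $0\le k\le m$. (3) $C_m^1$ has blocks $Y^1_k$ at $(k,k)$ for $0\le k\le m-1$, $Z^1_k$ at $(k,k+1)$ for $0\le k\le m-2$, and $X^1_k$ at $(k,k-1)$ for $1\le k\le m$. For $i=2,3$, $C_m^i$ has blocks $Y^i_k$ at $(k,k)$, $0\le k\le m-1$. Here $E^i_k\in\mathbb{R}^{(m+1-k)\times(m+2-k)}$, $V^i_k\in\mathbb{R}^{(m+1-k)\times(m+1-k)}$, $Y^i_k\in\mathbb{R}^{(m+1-k)\times(m-k)}$ are tridiagonal for $i=1,2$ and diagonal for $i=3$; $F^1_k\in\mathbb{R}^{(m+1-k)\times(m+1-k)}$, $W^1_k\in\mathbb{R}^{(m+1-k)\times(m-k)}$, $Z^1_k\in\mathbb{R}^{(m+1-k)\times(m-k-1)}$ are lower tridiagonal; and $G^1_k\in\mathbb{R}^{(m+1-k)\times(m+3-k)}$, $U^1_k\in\mathbb{R}^{(m+1-k)\times(m+2-k)}$, $X^1_k\in\mathbb{R}^{(m+1-k)\times(m+1-k)}$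 are upper tridiagonal.
   Context: $\mathbb{N}_0=\{0,1,2,\dots\}$. Reference tetrahedron: $\hat{\mathcal T}=\{(\hat x_1,\hat x_2,\hat x_3)^{\mathsf T}: 0\le\hat x_1,\hat x_2,\hat x_3,\ \hat x_1+\hat x_2+\hat x_3\le1\}$. $|\boldsymbol\ell^2|:=\ell_1+\ell_2$, $|\boldsymbol\alpha^1|:=\alpha_0+\alpha_1$, $|\boldsymbol\alpha^2|:=\alpha_0+\alpha_1+\alpha_2$. Generalized Jacobi polynomials. For $\alpha,\beta\ge-1$ and $k\in\mathbb{N}_0$, $$J_k^{\alpha,\beta}(z)=\sum_{j=0}^k\frac{(\alpha+j+1)_{k-j}(k+\alpha+\beta+1)_j}{j!(k-j)!}\Big(\frac{z-1}{2}\Big)^j,\quad (a)_n=a(a+1)\cdots(a+n-1),$$ except that $J_1^{-1,-1}(z):=z$. (In particular $J_0^{-1,-1}=1$ and $J_k^{-1,-1}=\frac{z-1}{2}\frac{z+1}{2}J_{k-2}^{1,1}$ for $k\ge2$.) Convention: $J_k^{\alpha,\beta}\equiv0$ for $k<0$. Generalized Koornwinder polynomials. For $\boldsymbol\alpha\in[-1,\infty)^4$, $\boldsymbol\ell\in\mathbb{N}_0^3$, $$\mathcal J_{\boldsymbol\ell}^{\boldsymbol\alpha}(\hat{\boldsymbol x})=(1-\hat x_2-\hat x_3)^{\ell_1}J_{\ell_1}^{\alpha_0,\alpha_1}\Big(\tfrac{2\hat x_1}{1-\hat x_2-\hat x_3}-1\Big)(1-\hat x_3)^{\ell_2}J_{\ell_2}^{2\ell_1+\alpha_0+\alpha_1+1,\alpha_2}\Big(\tfrac{2\hat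 x_2}{1-\hat x_3}-1\Big)J_{\ell_3}^{2\ell_1+2\ell_2+\alpha_0+\alpha_1+\alpha_2+2,\alpha_3}(2\hat x_3-1),$$ which is a polynomial in $\hat{\boldsymbol x}$. Any term containing $\mathcal J_{\boldsymbol k}^{\boldsymbol\alpha}$ with some negative index $k_i<0$ is zero (whether or not its coefficient is defined). One-dimensional coefficients, for $k\in\mathbb{N}_0$: - $(a_{1,k}^{\alpha,\beta},a_{2,k}^{\alpha,\beta},a_{3,k}^{\alpha,\beta})$ equals $(1,0,0)$ if $k=0,\alpha=\beta=-1$; $\big(\frac{2}{\alpha+\beta+2},\frac{\beta-\alpha}{\alpha+\beta+2},0\big)$ if $k=0,\alpha+\beta\ne-2$; $(4,0,1)$ if $k=1,\alpha=\beta=-1$; $(\frac12,0,0)$ if $k=2,\alpha=\beta=-1$; and otherwise $\Big(\frac{2(k+1)(k+\alpha+\beta+1)}{(2k+\alpha+\beta+1)(2k+\alpha+\beta+2)},\frac{\beta^2-\alpha^2}{(2k+\alpha+\beta)(2k+\alpha+\beta+2)},\frac{2(k+\alpha)(k+\beta)}{(2k+\alpha+\beta)(2k+\alpha+\beta+1)}\Big)$. - $(b_{1,k}^{\alpha,\beta},b_{2,k}^{\alpha,\beta})$ equals $(1,0)$ if $k=0$; $(2,-1)$ if $k=1,\alpha=\beta=-1$; otherwise $\big(\frac{k+\alpha+\beta+1}{2k+\alpha+\beta+1},-\frac{k+\beta}{2k+\alpha+\beta+1}\big)$; and $b_{1,k}^{\alpha,\beta}=b_{2,k}^{\alpha,\beta}=0$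 for $k<0$. - $c_{1,k}^{\alpha,\beta}=b_{1,k}^{\alpha,\beta}b_{1,k}^{\alpha+1,\beta}$, $c_{2,k}^{\alpha,\beta}=b_{1,k}^{\alpha,\beta}b_{2,k}^{\alpha+1,\beta}+b_{2,k}^{\alpha,\beta}b_{1,k-1}^{\alpha+1,\beta}$, $c_{3,k}^{\alpha,\beta}=b_{2,k}^{\alpha,\beta}b_{2,k-1}^{\alpha+1,\beta}$. - $(e_{1,k}^{\alpha,\beta},e_{2,k}^{\alpha,\beta})$ equals $(\frac12,-\frac12)$ if $k=0,\alpha=\beta=-1$; $(0,-1)$ if $k=1,\alpha=\beta=-1$; otherwise $\big(\frac{k+\alpha+1}{2k+\alpha+\beta+2},-\frac{k+1}{2k+\alpha+\beta+2}\big)$. - $g_{1,k}^{\alpha,\beta}=e_{2,k}^{\alpha+1,\beta}e_{2,k+1}^{\alpha,\beta}$, $g_{2,k}^{\alpha,\beta}=e_{1,k}^{\alpha+1,\beta}e_{2,k}^{\alpha,\beta}+e_{2,k}^{\alpha+1,\beta}e_{1,k+1}^{\alpha,\beta}$, $g_{3,k}^{\alpha,\beta}=e_{1,k}^{\alpha+1,\beta}e_{1,k}^{\alpha,\beta}$. Coefficients of the recurrences. Put $A:=2\ell_1+|\boldsymbol\alpha^1|+1$ and $B:=2|\boldsymbol\ell^2|+|\boldsymbol\alpha^2|+2$, and $$(T_{-1,-1},T_{-1,0},T_{-1,1})=\tfrac12\big(c_{1,\ell_3}^{B,\alpha_3},c_{2,\ell_3}^{B,\alpha_3},c_{3,\ell_3}^{B,\alpha_3}\big),$$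 $$(T_{0,-1},T_{0,0},T_{0,1})=\tfrac12\big(-a_{1,\ell_3}^{B,\alpha_3},\,1-a_{2,\ell_3}^{B,\alpha_3},\,-a_{3,\ell_3}^{B,\alpha_3}\big),$$ $$(T_{1,-1},T_{1,0},T_{1,1})=\tfrac12\big(g_{1,\ell_3}^{B-2,\alpha_3},g_{2,\ell_3}^{B-2,\alpha_3},g_{3,\ell_3}^{B-2,\alpha_3}\big).$$ For $r\in\{-1,0,1\}$: $$\mathscr C_{-1,-1,r}=a_{1,\ell_1}^{\alpha_0,\alpha_1}c_{1,\ell_2}^{A,\alpha_2}T_{-1,r},\quad \mathscr C_{-1,0,r}=\tfrac12a_{1,\ell_1}^{\alpha_0,\alpha_1}c_{2,\ell_2}^{A,\alpha_2}T_{0,r},\quad \mathscr C_{-1,1,r}=a_{1,\ell_1}^{\alpha_0,\alpha_1}c_{3,\ell_2}^{A,\alpha_2}T_{1,r},$$ $$\mathscr C_{0,-1,r}=-\tfrac12(1+a_{2,\ell_1}^{\alpha_0,\alpha_1})a_{1,\ell_2}^{A,\alpha_2}T_{-1,r},\quad \mathscr C_{0,0,r}=\tfrac14(1+a_{2,\ell_1}^{\alpha_0,\alpha_1})(1-a_{2,\ell_2}^{A,\alpha_2})T_{0,r},\quad \mathscr C_{0,1,r}=-\tfrac12(1+a_{2,\ell_1}^{\alpha_0,\alpha_1})a_{3,\ell_2}^{A,\alpha_2}T_{1,r},$$ $$\mathscr C_{1,-1,r}=a_{3,\ell_1}^{\alpha_0,\alpha_1}g_{1,\ell_2}^{A-2,\alpha_2}T_{-1,r},\quad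 \mathscr C_{1,0,r}=\tfrac12a_{3,\ell_1}^{\alpha_0,\alpha_1}g_{2,\ell_2}^{A-2,\alpha_2}T_{0,r},\quad \mathscr C_{1,1,r}=a_{3,\ell_1}^{\alpha_0,\alpha_1}g_{3,\ell_2}^{A-2,\alpha_2}T_{1,r},$$ $$\mathscr C_{-1,r}=a_{1,\ell_2}^{A,\alpha_2}T_{-1,r},\quad \mathscr C_{0,r}=\tfrac12(1+a_{2,\ell_2}^{A,\alpha_2})T_{0,r},\quad \mathscr C_{1,r}=a_{3,\ell_2}^{A,\alpha_2}T_{1,r},$$ (the last line being the two-index coefficients $\mathscr C_{q,r}$), and $$(\mathscr C_{-1},\mathscr C_0,\mathscr C_1)=\tfrac12\big(a_{1,\ell_3}^{B,\alpha_3},\,1+a_{2,\ell_3}^{B,\alpha_3},\,a_{3,\ell_3}^{B,\alpha_3}\big).$$ Vector notation. $r_m:=\binom{m+2}{m}$ for $m\ge0$, $r_{-1}:=0$. For fixed $\boldsymbol\alpha$, $\mathbf P^m\in\mathbb{R}^{r_m\times1}$ is the column vector obtained by stacking $\mathbf P_0^m,\dots,\mathbf P_m^m$, where $\mathbf P_k^m=(\mathcal J^{\boldsymbol\alpha}_{k,0,m-k}(\hat{\boldsymbol x}),\mathcal J^{\boldsymbol\alpha}_{k,1,m-k-1}(\hat{\boldsymbol x}),\dots,\mathcal J^{\boldsymbol\alpha}_{k,m-k,0}(\hat{\boldsymbol x}))^{\mathsf T}$; $\mathbf P^{-1}$ is empty (the term $C_0\mathbf P^{-1}$ is absent). For a rectangular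 matrix with entries $(i,j)$: diagonal means nonzero entries only for $i=j$; tridiagonal only for $|i-j|\le1$; lower tridiagonal only for $0\le i-j\le2$; upper tridiagonal only for $0\le j-i\le2$. $I$ is an identity matrix of the appropriate size. *)

theory Defs
  imports Complex_Main "HOL-Library.Product_Plus" "Jordan_Normal_Form.Matrix"
begin

type_synonym point = "real \<times> real \<times> real"
type_synonym index = "int \<times> int \<times> int"
type_synonym param = "real \<times> real \<times> real \<times> real"

definition ref_tetrahedron :: "point set" where
  "ref_tetrahedron = {(x1, x2, x3). 0 \<le> x1 \<and> 0 \<le> x2 \<and> 0 \<le> x3 \<and> x1 + x2 + x3 \<le> 1}"

section \<open>Generalized Jacobi and Koornwinder polynomials\<close>

text \<open>Indices and degrees are integers, so that index shifts never truncate; polynomials with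
  a negative index are zero.\<close>

definition jacobi :: "int \<Rightarrow> real \<Rightarrow> real \<Rightarrow> real \<Rightarrow> real" where
  "jacobi k \<alpha> \<beta> z =
    (if k < 0 then 0
     else if k = 1 \<and> \<alpha> = -1 \<and> \<beta> = -1 then z
     else (\<Sum>j=0..nat k.
       pochhammer (\<alpha> + real j + 1) (nat k - j) * pochhammer (of_int k + \<alpha> + \<beta> + 1) j
         / (fact j * fact (nat k - j)) * ((z - 1) / 2) ^ j))"

text \<open>The quotients below are singular at the points of the reference tetrahedron with
  \<open>1 - x2 - x3 = 0\<close> (where \<open>x1 = 0\<close>) or \<open>1 - x3 = 0\<close> (where \<open>x2 = 0\<close>). There the convention
  \<open>x / 0 = 0\<close> gives the value of the polynomial extension: see \<open>power_mult_jacobi\<close>,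
  whose right-hand side is polynomial in \<open>s\<close> and \<open>t\<close>.\<close>

fun koornwinder :: "param \<Rightarrow> index \<Rightarrow> point \<Rightarrow> real" where
  "koornwinder (\<alpha>0, \<alpha>1, \<alpha>2, \<alpha>3) (l1, l2, l3) (x1, x2, x3) =
    (if l1 < 0 \<or> l2 < 0 \<or> l3 < 0 then 0
     else (1 - x2 - x3) ^ nat l1 * jacobi l1 \<alpha>0 \<alpha>1 (2 * x1 / (1 - x2 - x3) - 1)
        * ((1 - x3) ^ nat l2
            * jacobi l2 (2 * of_int l1 + \<alpha>0 + \<alpha>1 + 1) \<alpha>2 (2 * x2 / (1 - x3) - 1))
        * jacobi l3 (2 * of_int l1 + 2 * of_int l2 + \<alpha>0 + \<alpha>1 + \<alpha>2 + 2) \<alpha>3 (2 * x3 - 1))"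

lemma power_mult_jacobi:
  assumes "t = 0 \<Longrightarrow> s = 0"
  shows "t ^ k * jacobi (int k) \<alpha> \<beta> (2 * s / t - 1) =
    (if k = 1 \<and> \<alpha> = -1 \<and> \<beta> = -1 then 2 * s - t
     else (\<Sum>j=0..k.
       pochhammer (\<alpha> + real j + 1) (k - j) * pochhammer (real k + \<alpha> + \<beta> + 1) j
         / (fact j * fact (k - j)) * (s - t) ^ j * t ^ (k - j)))"
proof (cases "t = 0")
  case True
  then have s: "s = 0" using assms by simp
  show ?thesis
  proof (cases "k = 0")
    case True then show ?thesis by (simp add: jacobi_def)
  next
    case False
    then have z: "(0::real) ^ j * 0 ^ (k - j) = 0" if "j \<le> k" for j
      using that by (cases "j = 0") auto
    have "(\<Sum>j=0..k. c j * (0 ^ j * 0 ^ (k - j))) = 0" for c :: "nat \<Rightarrow> real"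
      by (intro sum.neutral ballI) (simp only: z atLeastAtMost_iff mult_zero_right)
    then have "(\<Sum>j=0..k. c j * (s - t) ^ j * t ^ (k - j)) = 0" for c :: "nat \<Rightarrow> real"
      using \<open>t = 0\<close> s by (simp only: mult.assoc diff_self)
    moreover have "t ^ k = 0" using False \<open>t = 0\<close> by simp
    ultimately show ?thesis using \<open>t = 0\<close> s by (simp only: mult_zero_left mult_zero_right diff_self if_cancel)
  qed
next
  case False
  have p: "t ^ k * ((2 * s / t - 1 - 1) / 2) ^ j = (s - t) ^ j * t ^ (k - j)" if "j \<le> k" for j
  proof -
    have h: "(2 * s / t - 1 - 1) / 2 = (s - t) / t" using False by (simp add: field_simps)
    show ?thesis unfolding h using False that by (simp add: power_divide power_diff)
  qed
  show ?thesis
  proof (cases "k = 1 \<and> \<alpha> = -1 \<and> \<beta> = -1")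
    case True then show ?thesis using False by (simp add: jacobi_def field_simps)
  next
    case n: False
    let ?c = "\<lambda>j. pochhammer (\<alpha> + real j + 1) (k - j) * pochhammer (real k + \<alpha> + \<beta> + 1) j
         / (fact j * fact (k - j))"
    have "jacobi (int k) \<alpha> \<beta> (2 * s / t - 1) = (\<Sum>j=0..k. ?c j * ((2 * s / t - 1 - 1) / 2) ^ j)"
      using n by (auto simp: jacobi_def)
    then have "t ^ k * jacobi (int k) \<alpha> \<beta> (2 * s / t - 1)
        = (\<Sum>j=0..k. ?c j * (t ^ k * ((2 * s / t - 1 - 1) / 2) ^ j))"
      by (simp only: sum_distrib_left mult.left_commute)
    also have "\<dots> = (\<Sum>j=0..k. ?c j * ((s - t) ^ j * t ^ (k - j)))"
      by (intro sum.cong refl) (simp only: p atLeastAtMost_iff)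
    finally show ?thesis using n by (simp only: mult.assoc if_False)
  qed
qed

section \<open>One-dimensional coefficients\<close>

definition jac_a :: "int \<Rightarrow> real \<Rightarrow> real \<Rightarrow> real \<times> real \<times> real" where
  "jac_a k \<alpha> \<beta> =
    (if k = 0 \<and> \<alpha> = -1 \<and> \<beta> = -1 then (1, 0, 0)
     else if k = 0 \<and> \<alpha> + \<beta> \<noteq> -2 then (2 / (\<alpha> + \<beta> + 2), (\<beta> - \<alpha>) / (\<alpha> + \<beta> + 2), 0)
     else if k = 1 \<and> \<alpha> = -1 \<and> \<beta> = -1 then (4, 0, 1)
     else if k = 2 \<and> \<alpha> = -1 \<and> \<beta> = -1 then (1 / 2, 0, 0)
     else (2 * (of_int k + 1) * (of_int k + \<alpha> + \<beta> + 1)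
             / ((2 * of_int k + \<alpha> + \<beta> + 1) * (2 * of_int k + \<alpha> + \<beta> + 2)),
           (\<beta>\<^sup>2 - \<alpha>\<^sup>2) / ((2 * of_int k + \<alpha> + \<beta>) * (2 * of_int k + \<alpha> + \<beta> + 2)),
           2 * (of_int k + \<alpha>) * (of_int k + \<beta>)
             / ((2 * of_int k + \<alpha> + \<beta>) * (2 * of_int k + \<alpha> + \<beta> + 1))))"

definition jac_b :: "int \<Rightarrow> real \<Rightarrow> real \<Rightarrow> real \<times> real" where
  "jac_b k \<alpha> \<beta> =
    (if k < 0 then (0, 0)
     else if k = 0 then (1, 0)
     else if k = 1 \<and> \<alpha> = -1 \<and> \<beta> = -1 then (2, -1)
     else ((of_int k + \<alpha> + \<beta> + 1) / (2 * of_int k + \<alpha> + \<beta> + 1),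
           - ((of_int k + \<beta>) / (2 * of_int k + \<alpha> + \<beta> + 1))))"

definition jac_c :: "int \<Rightarrow> real \<Rightarrow> real \<Rightarrow> real \<times> real \<times> real" where
  "jac_c k \<alpha> \<beta> =
    (let b1 = \<lambda>k \<alpha>. fst (jac_b k \<alpha> \<beta>); b2 = \<lambda>k \<alpha>. snd (jac_b k \<alpha> \<beta>) in
      (b1 k \<alpha> * b1 k (\<alpha> + 1),
       b1 k \<alpha> * b2 k (\<alpha> + 1) + b2 k \<alpha> * b1 (k - 1) (\<alpha> + 1),
       b2 k \<alpha> * b2 (k - 1) (\<alpha> + 1)))"

definition jac_e :: "int \<Rightarrow> real \<Rightarrow> real \<Rightarrow> real \<times> real" where
  "jac_e k \<alpha> \<beta> =
    (if k = 0 \<and> \<alpha> = -1 \<and> \<beta> = -1 then (1 / 2, - (1 / 2))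
     else if k = 1 \<and> \<alpha> = -1 \<and> \<beta> = -1 then (0, -1)
     else ((of_int k + \<alpha> + 1) / (2 * of_int k + \<alpha> + \<beta> + 2),
           - ((of_int k + 1) / (2 * of_int k + \<alpha> + \<beta> + 2))))"

definition jac_g :: "int \<Rightarrow> real \<Rightarrow> real \<Rightarrow> real \<times> real \<times> real" where
  "jac_g k \<alpha> \<beta> =
    (let e1 = \<lambda>k \<alpha>. fst (jac_e k \<alpha> \<beta>); e2 = \<lambda>k \<alpha>. snd (jac_e k \<alpha> \<beta>) in
      (e2 k (\<alpha> + 1) * e2 (k + 1) \<alpha>,
       e1 k (\<alpha> + 1) * e2 k \<alpha> + e2 k (\<alpha> + 1) * e1 (k + 1) \<alpha>,
       e1 k (\<alpha> + 1) * e1 k \<alpha>))"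

section \<open>Coefficients of the recurrences\<close>

text \<open>\<open>at3 p (u, v, w)\<close> selects from a family indexed by \<open>p = -1, 0, 1\<close>.\<close>

fun at3 :: "int \<Rightarrow> 'a \<times> 'a \<times> 'a \<Rightarrow> 'a" where
  "at3 p (u, v, w) = (if p = -1 then u else if p = 0 then v else w)"

fun koorn_T :: "index \<Rightarrow> param \<Rightarrow> int \<Rightarrow> int \<Rightarrow> real" where
  "koorn_T (l1, l2, l3) (\<alpha>0, \<alpha>1, \<alpha>2, \<alpha>3) q r =
    (let B = 2 * of_int (l1 + l2) + (\<alpha>0 + \<alpha>1 + \<alpha>2) + 2;
         (a1, a2, a3) = jac_a l3 B \<alpha>3;
         (c1, c2, c3) = jac_c l3 B \<alpha>3;
         (g1, g2, g3) = jac_g l3 (B - 2) \<alpha>3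
     in 1 / 2 * at3 r (at3 q ((c1, c2, c3), (- a1, 1 - a2, - a3), (g1, g2, g3))))"

fun koorn_C3 :: "index \<Rightarrow> param \<Rightarrow> int \<Rightarrow> int \<Rightarrow> int \<Rightarrow> real" where
  "koorn_C3 (l1, l2, l3) (\<alpha>0, \<alpha>1, \<alpha>2, \<alpha>3) p q r =
    (let A = 2 * of_int l1 + (\<alpha>0 + \<alpha>1) + 1;
         (a1, a2, a3) = jac_a l1 \<alpha>0 \<alpha>1;
         (a1', a2', a3') = jac_a l2 A \<alpha>2;
         (c1, c2, c3) = jac_c l2 A \<alpha>2;
         (g1, g2, g3) = jac_g l2 (A - 2) \<alpha>2
     in at3 q (at3 p
          ((a1 * c1, 1 / 2 * a1 * c2, a1 * c3),
           (- (1 / 2) * (1 + a2) * a1', 1 / 4 * (1 + a2) * (1 - a2'), - (1 / 2) * (1 + a2) * a3'),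
           (a3 * g1, 1 / 2 * a3 * g2, a3 * g3)))
        * koorn_T (l1, l2, l3) (\<alpha>0, \<alpha>1, \<alpha>2, \<alpha>3) q r)"

fun koorn_C2 :: "index \<Rightarrow> param \<Rightarrow> int \<Rightarrow> int \<Rightarrow> real" where
  "koorn_C2 (l1, l2, l3) (\<alpha>0, \<alpha>1, \<alpha>2, \<alpha>3) q r =
    (let A = 2 * of_int l1 + (\<alpha>0 + \<alpha>1) + 1;
         (a1, a2, a3) = jac_a l2 A \<alpha>2
     in at3 q (a1, 1 / 2 * (1 + a2), a3) * koorn_T (l1, l2, l3) (\<alpha>0, \<alpha>1, \<alpha>2, \<alpha>3) q r)"

fun koorn_C1 :: "index \<Rightarrow> param \<Rightarrow> int \<Rightarrow> real" where
  "koorn_C1 (l1, l2, l3) (\<alpha>0, \<alpha>1, \<alpha>2, \<alpha>3) r =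
    (let B = 2 * of_int (l1 + l2) + (\<alpha>0 + \<alpha>1 + \<alpha>2) + 2;
         (a1, a2, a3) = jac_a l3 B \<alpha>3
     in 1 / 2 * at3 r (a1, 1 + a2, a3))"

section \<open>Vector and matrix notation\<close>

definition koorn_dim :: "int \<Rightarrow> nat" where
  "koorn_dim m = (if m < 0 then 0 else nat (m + 2) choose nat m)"

text \<open>For \<open>m = -1\<close> the list is empty, so the vector has dimension \<open>0\<close>.\<close>

definition koorn_vec :: "param \<Rightarrow> int \<Rightarrow> point \<Rightarrow> real vec" where
  "koorn_vec \<alpha> m x =
    vec_of_list (concat (map (\<lambda>k. map (\<lambda>j. koornwinder \<alpha> (k, j, m - k - j) x) [0..m - k]) [0..m]))"

definition tridiagonal :: "real mat \<Rightarrow> bool" where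
  "tridiagonal M \<longleftrightarrow>
    (\<forall>i<dim_row M. \<forall>j<dim_col M. M $$ (i, j) \<noteq> 0 \<longrightarrow> \<bar>int i - int j\<bar> \<le> 1)"

definition lower_tridiagonal :: "real mat \<Rightarrow> bool" where
  "lower_tridiagonal M \<longleftrightarrow>
    (\<forall>i<dim_row M. \<forall>j<dim_col M. M $$ (i, j) \<noteq> 0 \<longrightarrow> 0 \<le> int i - int j \<and> int i - int j \<le> 2)"

definition upper_tridiagonal :: "real mat \<Rightarrow> bool" where
  "upper_tridiagonal M \<longleftrightarrow>
    (\<forall>i<dim_row M. \<forall>j<dim_col M. M $$ (i, j) \<noteq> 0 \<longrightarrow> 0 \<le> int j - int i \<and> int j - int i \<le> 2)"

text \<open>\<open>block p n M k j\<close> is the block of \<open>M\<close> at position \<open>(k, j)\<close> when the rows of \<open>M\<close> are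
  partitioned into block rows \<open>0, \<dots>, p - 1\<close> of heights \<open>p, p - 1, \<dots>, 1\<close> and the columns into
  block columns \<open>0, \<dots>, n - 1\<close> of widths \<open>n, n - 1, \<dots>, 1\<close>.\<close>

definition block :: "nat \<Rightarrow> nat \<Rightarrow> real mat \<Rightarrow> nat \<Rightarrow> nat \<Rightarrow> real mat" where
  "block p n M k j =
    mat (p - k) (n - j) (\<lambda>(a, b). M $$ ((\<Sum>i<k. p - i) + a, (\<Sum>i<j. n - i) + b))"

definition block_diagonal_form :: "nat \<Rightarrow> nat \<Rightarrow> (nat \<Rightarrow> real mat) \<Rightarrow> real mat \<Rightarrow> bool" where
  "block_diagonal_form p n D M \<longleftrightarrow>
    (\<forall>k<p. \<forall>j<n. block p n M k j = (if j = k then D k else 0\<^sub>m (p - k) (n - j)))"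

text \<open>\<open>L k\<close>, \<open>D k\<close>, \<open>R k\<close> sit at block positions \<open>(k, k - 1)\<close>, \<open>(k, k)\<close>, \<open>(k, k + 1)\<close>.\<close>

definition block_tridiagonal_form ::
  "nat \<Rightarrow> nat \<Rightarrow> (nat \<Rightarrow> real mat) \<Rightarrow> (nat \<Rightarrow> real mat) \<Rightarrow> (nat \<Rightarrow> real mat) \<Rightarrow> real mat \<Rightarrow> bool" where
  "block_tridiagonal_form p n L D R M \<longleftrightarrow>
    (\<forall>k<p. \<forall>j<n. block p n M k j =
      (if j = k then D k else if j = k + 1 then R k else if k = j + 1 then L k
       else 0\<^sub>m (p - k) (n - j)))"

text \<open>The superscript \<open>i\<close> of a block is the first argument of the corresponding family, and the
  blocks are chosen before the point \<open>(x1, x2, x3)\<close>, i.e. do not depend on it.\<close>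

definition A_form :: "nat \<Rightarrow> real mat \<Rightarrow> bool" where
  "A_form m A \<longleftrightarrow>
    (\<exists>A1 A2 A3 E F G.
      A1 \<in> carrier_mat (koorn_dim m) (koorn_dim (int m + 1)) \<and>
      A2 \<in> carrier_mat (koorn_dim m) (koorn_dim (int m + 1)) \<and>
      A3 \<in> carrier_mat (koorn_dim m) (koorn_dim (int m + 1)) \<and>
      A = A1 @\<^sub>r A2 @\<^sub>r A3 \<and>
      (\<forall>k\<le>m. \<forall>i\<in>{1,2,3::nat}. E i k \<in> carrier_mat (m + 1 - k) (m + 2 - k)) \<and>
      (\<forall>k\<le>m. tridiagonal (E 1 k) \<and> tridiagonal (E 2 k) \<and> diagonal_mat (E 3 k)) \<and>
      (\<forall>k\<le>m. F k \<in> carrier_mat (m + 1 - k) (m + 1 - k) \<and> lower_tridiagonal (F k)) \<and>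
      (\<forall>k\<in>{1..m}. G k \<in> carrier_mat (m + 1 - k) (m + 3 - k) \<and> upper_tridiagonal (G k)) \<and>
      block_tridiagonal_form (m + 1) (m + 2) G (E 1) F A1 \<and>
      block_diagonal_form (m + 1) (m + 2) (E 2) A2 \<and>
      block_diagonal_form (m + 1) (m + 2) (E 3) A3)"

definition B_form :: "nat \<Rightarrow> (point \<Rightarrow> real mat) \<Rightarrow> bool" where
  "B_form m B \<longleftrightarrow>
    (\<exists>V W U.
      (\<forall>k\<le>m. \<forall>i\<in>{1,2,3::nat}. V i k \<in> carrier_mat (m + 1 - k) (m + 1 - k)) \<and>
      (\<forall>k\<le>m. tridiagonal (V 1 k) \<and> tridiagonal (V 2 k) \<and> diagonal_mat (V 3 k)) \<and>
      (\<forall>k<m. W k \<in> carrier_mat (m + 1 - k) (m - k) \<and> lower_tridiagonal (W k)) \<and>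
      (\<forall>k\<in>{1..m}. U k \<in> carrier_mat (m + 1 - k) (m + 2 - k) \<and> upper_tridiagonal (U k)) \<and>
      (\<forall>x1 x2 x3. \<exists>B1 B2 B3.
        B1 \<in> carrier_mat (koorn_dim m) (koorn_dim m) \<and>
        B2 \<in> carrier_mat (koorn_dim m) (koorn_dim m) \<and>
        B3 \<in> carrier_mat (koorn_dim m) (koorn_dim m) \<and>
        B (x1, x2, x3) = B1 @\<^sub>r B2 @\<^sub>r B3 \<and>
        block_tridiagonal_form (m + 1) (m + 1)
          U (\<lambda>k. V 1 k - x1 \<cdot>\<^sub>m 1\<^sub>m (m + 1 - k)) W B1 \<and>
        block_diagonal_form (m + 1) (m + 1) (\<lambda>k. V 2 k - x2 \<cdot>\<^sub>m 1\<^sub>m (m + 1 - k)) B2 \<and>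
        block_diagonal_form (m + 1) (m + 1) (\<lambda>k. V 3 k - x3 \<cdot>\<^sub>m 1\<^sub>m (m + 1 - k)) B3))"

definition C_form :: "nat \<Rightarrow> real mat \<Rightarrow> bool" where
  "C_form m C \<longleftrightarrow>
    (\<exists>C1 C2 C3 Y Z X.
      C1 \<in> carrier_mat (koorn_dim m) (koorn_dim (int m - 1)) \<and>
      C2 \<in> carrier_mat (koorn_dim m) (koorn_dim (int m - 1)) \<and>
      C3 \<in> carrier_mat (koorn_dim m) (koorn_dim (int m - 1)) \<and>
      C = C1 @\<^sub>r C2 @\<^sub>r C3 \<and>
      (\<forall>k<m. \<forall>i\<in>{1,2,3::nat}. Y i k \<in> carrier_mat (m + 1 - k) (m - k)) \<and>
      (\<forall>k<m. tridiagonal (Y 1 k) \<and> tridiagonal (Y 2 k) \<and> diagonal_mat (Y 3 k)) \<and>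
      (\<forall>k. k + 2 \<le> m \<longrightarrow>
        Z k \<in> carrier_mat (m + 1 - k) (m - k - 1) \<and> lower_tridiagonal (Z k)) \<and>
      (\<forall>k\<in>{1..m}. X k \<in> carrier_mat (m + 1 - k) (m + 1 - k) \<and> upper_tridiagonal (X k)) \<and>
      block_tridiagonal_form (m + 1) m X (Y 1) Z C1 \<and>
      block_diagonal_form (m + 1) m (Y 2) C2 \<and>
      block_diagonal_form (m + 1) m (Y 3) C3)"

end

theory Submission
  imports Defs
begin

text \<open>
  In the collapsed coordinates \<open>y = 2 x1 / t1 - 1\<close>, \<open>w = 2 x2 / t2 - 1\<close>, \<open>z = 2 x3 - 1\<close>, where
  \<open>t1 = 1 - x2 - x3\<close> and \<open>t2 = 1 - x3\<close>, a Koornwinder polynomial is a product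
  \<open>t1 ^ l1 J(y) \<cdot> t2 ^ l2 J(w) \<cdot> J(z)\<close> of Jacobi polynomials. The first parameter of the second factor
  is \<open>A = 2 l1 + \<dots>\<close> and that of the third is \<open>B = 2 l1 + 2 l2 + \<dots>\<close>. Moreover
  \<open>x1 = t1 (1 + y) / 2\<close>, \<open>x2 = t2 (1 + w) / 2\<close>, \<open>x3 = (1 + z) / 2\<close>, \<open>t1 = t2 (1 - w) / 2\<close> and
  \<open>t2 = (1 - z) / 2\<close>. These five identities also hold where a quotient degenerates, because the
  numerator vanishes there too; so the argument below is valid on the whole closed tetrahedron.

  Multiplication by \<open>x1\<close> acts on the first factor by the three-term recurrence in \<open>y\<close>
  (\<open>jacobi_mult\<close>), which replaces \<open>l1\<close> by \<open>l1 - p\<close>. Two things are then wrong: \<open>p + 1\<close> powers of \<open>t1\<close> are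
  left over, and the second factor carries the parameter \<open>A\<close> where \<open>A - 2 p\<close> is required. Both defects
  are removed by one identity (\<open>jacobi_shift\<close>), which expands \<open>((1 - w) / 2) ^ (p + 1) J(w)\<close> with
  parameter \<open>A\<close> in three polynomials with parameter \<open>A - 2 p\<close>. The degree drops by
  \<open>q - p\<close>, and the same pair of defects reappears one level further in, now with \<open>t2\<close>, \<open>B\<close> and \<open>q\<close>;
  a second use of the identity, in \<open>z\<close>, finishes the computation. So every coefficient is a product of
  one-dimensional ones (\<open>koorn_C3_factor\<close>). For \<open>x2\<close> and \<open>x3\<close> the process starts at the second and third
  factor. In one dimension everything rests on two connection formulas, one raising the first
  parameter and one lowering it at the price of a factor \<open>(1 - z) / 2\<close>: their composition in one order
  is the three-term recurrence, and their iterates are the cases \<open>p = -1\<close> and \<open>p = 1\<close> of the shift.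

  For the matrix form, consider the row of the polynomial with index \<open>(k, a, m - k - a)\<close>. The term of its
  recurrence with shifts \<open>p, q, r\<close> has total degree \<open>m - r\<close> and lies in block column \<open>k - p\<close>, at column
  \<open>a + p - q\<close> of that block. Sorting the coefficients by \<open>r\<close> gives the three
  matrices, \<open>p \<in> {-1, 0, 1}\<close> gives the block tridiagonal shape and \<open>q \<in> {-1, 0, 1}\<close> the bands inside the blocks.
  The matrices are unique because the Koornwinder polynomials are linearly independent on the
  tetrahedron (\<open>koornwinder_independent\<close>), which follows from the exact degree of each Jacobi factor, and because the
  prescribed form leaves only constants free in \<open>B\<close> (\<open>B_form_entry\<close>).
\<close>

section \<open>Connection formulas for Jacobi polynomials\<close>

text \<open>The coefficients of a Jacobi polynomial in the powers of \<open>(z - 1) / 2\<close>. The value \<open>0\<close> beyond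
  the degree lets polynomials of different degrees be summed over one common range.\<close>


definition jacobi_coeff :: "nat \<Rightarrow> real \<Rightarrow> real \<Rightarrow> nat \<Rightarrow> real" where
  "jacobi_coeff k \<alpha> \<beta> j =
    (if k < j then 0
     else pochhammer (\<alpha> + real j + 1) (k - j) * pochhammer (real k + \<alpha> + \<beta> + 1) j
            / (fact j * fact (k - j)))"

lemma jacobi_expansion:
  assumes "\<not> (k = 1 \<and> \<alpha> = -1 \<and> \<beta> = -1)" and "k \<le> n"
  shows "jacobi (int k) \<alpha> \<beta> z = (\<Sum>j\<le>n. jacobi_coeff k \<alpha> \<beta> j * ((z - 1) / 2) ^ j)"
proof -
  have "jacobi (int k) \<alpha> \<beta> z = (\<Sum>j=0..k. jacobi_coeff k \<alpha> \<beta> j * ((z - 1) / 2) ^ j)"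
    using assms(1) by (auto simp: jacobi_def jacobi_coeff_def intro!: sum.cong)
  also have "\<dots> = (\<Sum>j\<le>n. jacobi_coeff k \<alpha> \<beta> j * ((z - 1) / 2) ^ j)"
    using assms(2) by (intro sum.mono_neutral_left) (auto simp: jacobi_coeff_def)
  finally show ?thesis .
qed

lemma jacobi_neg [simp]: "k < 0 \<Longrightarrow> jacobi k \<alpha> \<beta> z = 0"
  by (simp add: jacobi_def)

lemma jacobi_0 [simp]: "jacobi 0 \<alpha> \<beta> z = 1"
  by (simp add: jacobi_def)

lemma jacobi_1: "\<not> (\<alpha> = -1 \<and> \<beta> = -1) \<Longrightarrow>
    jacobi 1 \<alpha> \<beta> z = \<alpha> + 1 + (\<alpha> + \<beta> + 2) * ((z - 1) / 2)"
  by (auto simp: jacobi_def)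

lemma jacobi_1_exceptional: "jacobi 1 (-1) (-1) z = z"
  by (simp add: jacobi_def)

lemma jacobi_2_exceptional: "jacobi 2 (-1) (-1) z = (z - 1) * (z + 1) / 4"
  by (simp add: jacobi_def eval_nat_numeral pochhammer_Suc field_simps)

text \<open>Both sides are \<open>s (s + 1) \<cdots> (s + n)\<close>.\<close>
lemma pochhammer_shift: "s * pochhammer (s + 1) n = pochhammer s n * (s + real n)"
  using pochhammer_rec[of s n] pochhammer_rec'[of s n] by (simp add: mult.commute)

text \<open>With \<open>s = k + \<alpha> + \<beta> + 1\<close>, for \<open>j < k\<close> all three coefficients share the factor
  \<open>(\<alpha> + j + 2)\<^sub>k\<^sub>-\<^sub>1\<^sub>-\<^sub>j (s)\<^sub>j / (j! (k - j)!)\<close>, because \<open>s (s + 1)\<^sub>j = (s)\<^sub>j (s + j)\<close>. What remains is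
  \<open>(2 k + \<alpha> + \<beta> + 1) (\<alpha> + j + 1) = (s + j) (\<alpha> + k + 1) - (k + \<beta>) (k - j)\<close>.\<close>
lemma jacobi_coeff_connection:
  assumes "1 \<le> k"
  shows "(2 * real k + \<alpha> + \<beta> + 1) * jacobi_coeff k \<alpha> \<beta> j =
    (real k + \<alpha> + \<beta> + 1) * jacobi_coeff k (\<alpha> + 1) \<beta> j
      - (real k + \<beta>) * jacobi_coeff (k - 1) (\<alpha> + 1) \<beta> j"
proof -
  consider "k < j" | "k = j" | d where "k = Suc (j + d)"
    by (metis less_imp_Suc_add nat_neq_iff)
  then show ?thesis
  proof cases
    case 2
    have "(2 * real k + \<alpha> + \<beta> + 1) * pochhammer (real k + \<alpha> + \<beta> + 1) k
        = (real k + \<alpha> + \<beta> + 1) * pochhammer (real k + \<alpha> + \<beta> + 1 + 1) k"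
      unfolding pochhammer_shift by simp
    then show ?thesis using 2 assms by (simp add: jacobi_coeff_def add_ac)
  next
    case 3
    define s where "s = real k + \<alpha> + \<beta> + 1"
    define P where "P = pochhammer (\<alpha> + real j + 2) d"
    define Q where "Q = pochhammer s j"
    define D :: real where "D = fact j * fact d"
    have D: "D \<noteq> 0" by (simp add: D_def)
    have h0: "jacobi_coeff k \<alpha> \<beta> j = (\<alpha> + real j + 1) * P * Q / (D * (real d + 1))"
      unfolding jacobi_coeff_def P_def Q_def D_def 3 s_def
      by (simp add: pochhammer_rec algebra_simps)
    have h1: "s * jacobi_coeff k (\<alpha> + 1) \<beta> j
        = P * (\<alpha> + real j + 2 + real d) * Q * (s + real j) / (D * (real d + 1))"
    proof -
      have "jacobi_coeff k (\<alpha> + 1) \<beta> j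
          = P * (\<alpha> + real j + 2 + real d) * pochhammer (s + 1) j / (D * (real d + 1))"
        unfolding jacobi_coeff_def P_def Q_def D_def 3 s_def
        by (simp add: pochhammer_rec' algebra_simps)
      then have "s * jacobi_coeff k (\<alpha> + 1) \<beta> j
          = P * (\<alpha> + real j + 2 + real d) * (s * pochhammer (s + 1) j) / (D * (real d + 1))"
        by simp
      then show ?thesis by (simp add: pochhammer_shift Q_def mult.assoc)
    qed
    have h2: "jacobi_coeff (k - 1) (\<alpha> + 1) \<beta> j = P * Q / D"
      unfolding jacobi_coeff_def P_def Q_def D_def 3 s_def
      by (simp add: algebra_simps)
    have k: "real k = real j + real d + 1" using 3 by simp
    have "(2 * real k + \<alpha> + \<beta> + 1) * jacobi_coeff k \<alpha> \<beta> j =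
        s * jacobi_coeff k (\<alpha> + 1) \<beta> j - (real k + \<beta>) * jacobi_coeff (k - 1) (\<alpha> + 1) \<beta> j"
      unfolding h0 h1 h2 using D
      by (simp add: divide_simps) (simp add: s_def k algebra_simps)
    then show ?thesis by (simp add: s_def)
  qed (simp add: jacobi_coeff_def)
qed

text \<open>The two lemmas below compare coefficients in
  \<open>- (2 k + \<alpha> + \<beta> + 2) u J\<^sub>k\<close> (parameter \<open>\<alpha> + 1\<close>) \<open>= (k + \<alpha> + 1) J\<^sub>k - (k + 1) J\<^sub>k\<^sub>+\<^sub>1\<close> (parameter \<open>\<alpha>\<close>),
  where \<open>u = (z - 1) / 2\<close>. The factor \<open>u\<close> shifts the index \<open>j\<close> by one, so the constant term has to cancel on
  the right.\<close>
lemma jacobi_coeff_weighted_0: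
  "(real k + \<alpha> + 1) * jacobi_coeff k \<alpha> \<beta> 0 = (real k + 1) * jacobi_coeff (Suc k) \<alpha> \<beta> 0"
proof -
  have "real k + 1 \<noteq> 0" by linarith
  then show ?thesis
    by (simp add: jacobi_coeff_def pochhammer_rec' divide_simps) (simp add: algebra_simps)
qed

lemma jacobi_coeff_weighted_Suc:
  "- (2 * real k + \<alpha> + \<beta> + 2) * jacobi_coeff k (\<alpha> + 1) \<beta> j =
    (real k + \<alpha> + 1) * jacobi_coeff k \<alpha> \<beta> (Suc j)
      - (real k + 1) * jacobi_coeff (Suc k) \<alpha> \<beta> (Suc j)"
proof -
  consider "k < j" | "k = j" | d where "k = Suc (j + d)"
    by (metis less_imp_Suc_add nat_neq_iff)
  then show ?thesis
  proof cases
    case 2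
    then show ?thesis
      by (simp add: jacobi_coeff_def pochhammer_rec' divide_simps) (simp add: algebra_simps)
  next
    case 3
    define s where "s = real k + \<alpha> + \<beta> + 1"
    define P where "P = pochhammer (\<alpha> + real j + 2) d"
    define Q where "Q = pochhammer (s + 1) j"
    define D :: real where "D = fact j * fact d"
    have D: "D \<noteq> 0" by (simp add: D_def)
    have h0: "jacobi_coeff k (\<alpha> + 1) \<beta> j
        = P * (\<alpha> + real j + 2 + real d) * Q / (D * (real d + 1))"
      unfolding jacobi_coeff_def P_def Q_def D_def 3 s_def
      by (simp add: pochhammer_rec' algebra_simps)
    have h1: "jacobi_coeff k \<alpha> \<beta> (Suc j) = P * (s * Q) / (D * (real j + 1))"
      unfolding jacobi_coeff_def P_def Q_def D_def 3 s_def
      by (simp add: pochhammer_rec algebra_simps)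
    have h2: "jacobi_coeff (Suc k) \<alpha> \<beta> (Suc j)
        = P * (\<alpha> + real j + 2 + real d) * (Q * (s + 1 + real j))
           / (D * (real d + 1) * (real j + 1))"
      unfolding jacobi_coeff_def P_def Q_def D_def 3 s_def
      by (simp add: pochhammer_rec' algebra_simps)
    have k: "real k = real j + real d + 1" using 3 by simp
    have n: "real j + 1 \<noteq> 0" "real d + 1 \<noteq> 0" by linarith+
    have "(real k + \<alpha> + 1) * jacobi_coeff k \<alpha> \<beta> (Suc j)
        - (real k + 1) * jacobi_coeff (Suc k) \<alpha> \<beta> (Suc j)
        = P * Q * (\<alpha> + real j + 2 + real d) / (D * (real d + 1) * (real j + 1))
          * (s * (real d + 1) - (real k + 1) * (s + 1 + real j))"
      unfolding h1 h2 k using D n by (simp add: divide_simps) (simp add: algebra_simps)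
    also have "s * (real d + 1) - (real k + 1) * (s + 1 + real j)
        = - (2 * real k + \<alpha> + \<beta> + 2) * (real j + 1)"
      by (simp add: s_def k algebra_simps)
    also have "P * Q * (\<alpha> + real j + 2 + real d) / (D * (real d + 1) * (real j + 1))
          * (- (2 * real k + \<alpha> + \<beta> + 2) * (real j + 1))
        = - (2 * real k + \<alpha> + \<beta> + 2) * jacobi_coeff k (\<alpha> + 1) \<beta> j"
      unfolding h0 using D n by (simp add: divide_simps)
    finally show ?thesis by simp
  qed (simp add: jacobi_coeff_def)
qed

lemma eq_scaled_sum:
  fixes d :: real
  assumes "d \<noteq> 0" "d * x = p * u - q * v"
  shows "x = p / d * u + - (q / d) * v"
  using assms by (simp add: field_simps)

text \<open>For \<open>\<alpha> = \<beta> = -1\<close> and \<open>k = 1\<close> the coefficient formula would make \<open>J\<^sub>1\<close> the zero polynomial, whereas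
  \<open>J\<^sub>1 = z\<close> by definition; this case is a separate computation. In the remaining cases \<open>k \<ge> 1\<close> and
  \<open>\<alpha>, \<beta> \<ge> -1\<close> keep the denominator \<open>2 k + \<alpha> + \<beta> + 1\<close> positive.\<close>
lemma jacobi_connection:
  assumes "-1 \<le> \<alpha>" "-1 \<le> \<beta>"
  shows "jacobi k \<alpha> \<beta> z =
    fst (jac_b k \<alpha> \<beta>) * jacobi k (\<alpha> + 1) \<beta> z + snd (jac_b k \<alpha> \<beta>) * jacobi (k - 1) (\<alpha> + 1) \<beta> z"
proof -
  consider "k < 0" | "k = 0" | "k = 1 \<and> \<alpha> = -1 \<and> \<beta> = -1"
    | n where "k = int n" "1 \<le> n" "\<not> (n = 1 \<and> \<alpha> = -1 \<and> \<beta> = -1)"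
  proof -
    consider "k < 0" | "k = 0" | n where "k = int n" "1 \<le> n"
      by (cases k rule: int_cases3) auto
    then show ?thesis using that by (metis of_nat_1)
  qed
  then show ?thesis
  proof cases
    case 3
    then show ?thesis by (simp add: jac_b_def jacobi_1 jacobi_1_exceptional field_simps)
  next
    case (4 n)
    let ?u = "(z - 1) / 2"
    have d: "0 < 2 * real n + \<alpha> + \<beta> + 1" using assms 4 by simp
    have i: "int n - 1 = int (n - 1)" using 4 by simp
    have "(2 * real n + \<alpha> + \<beta> + 1) * jacobi k \<alpha> \<beta> z
        = (\<Sum>j\<le>n. (2 * real n + \<alpha> + \<beta> + 1) * jacobi_coeff n \<alpha> \<beta> j * ?u ^ j)"
      using 4 by (simp add: jacobi_expansion[of n \<alpha> \<beta> n] sum_distrib_left mult.assoc)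
    also have "\<dots> = (\<Sum>j\<le>n. (real n + \<alpha> + \<beta> + 1) * (jacobi_coeff n (\<alpha> + 1) \<beta> j * ?u ^ j)
        - (real n + \<beta>) * (jacobi_coeff (n - 1) (\<alpha> + 1) \<beta> j * ?u ^ j))"
      by (intro sum.cong refl, subst jacobi_coeff_connection[OF 4(2)]) (simp only: left_diff_distrib mult.assoc)
    also have "\<dots> = (real n + \<alpha> + \<beta> + 1) * jacobi k (\<alpha> + 1) \<beta> z
        - (real n + \<beta>) * jacobi (k - 1) (\<alpha> + 1) \<beta> z"
    proof -
      have "jacobi k (\<alpha> + 1) \<beta> z = (\<Sum>j\<le>n. jacobi_coeff n (\<alpha> + 1) \<beta> j * ?u ^ j)"
        unfolding 4(1) using assms by (intro jacobi_expansion) auto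
      moreover have "jacobi (k - 1) (\<alpha> + 1) \<beta> z
          = (\<Sum>j\<le>n. jacobi_coeff (n - 1) (\<alpha> + 1) \<beta> j * ?u ^ j)"
        unfolding 4(1) i using assms by (intro jacobi_expansion) auto
      ultimately show ?thesis
        by (simp only: sum_distrib_left sum_subtractf)
    qed
    finally have "jacobi k \<alpha> \<beta> z
        = (real n + \<alpha> + \<beta> + 1) / (2 * real n + \<alpha> + \<beta> + 1) * jacobi k (\<alpha> + 1) \<beta> z
          + - ((real n + \<beta>) / (2 * real n + \<alpha> + \<beta> + 1)) * jacobi (k - 1) (\<alpha> + 1) \<beta> z"
      using d by (intro eq_scaled_sum) auto
    moreover have "jac_b k \<alpha> \<beta> = ((real n + \<alpha> + \<beta> + 1) / (2 * real n + \<alpha> + \<beta> + 1),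
        - ((real n + \<beta>) / (2 * real n + \<alpha> + \<beta> + 1)))"
      using 4 by (auto simp: jac_b_def)
    ultimately show ?thesis by simp
  qed (simp_all add: jac_b_def)
qed

text \<open>Here \<open>J\<^sub>1\<close> with \<open>\<alpha> = \<beta> = -1\<close> occurs on the right for \<open>k = 0\<close> and \<open>k = 1\<close>, so both are special.
  Otherwise the denominator \<open>2 k + \<alpha> + \<beta> + 2\<close> is positive.\<close>
lemma jacobi_weighted_connection:
  assumes "-1 \<le> \<alpha>" "-1 \<le> \<beta>" "0 \<le> k"
  shows "(1 - z) / 2 * jacobi k (\<alpha> + 1) \<beta> z =
    fst (jac_e k \<alpha> \<beta>) * jacobi k \<alpha> \<beta> z + snd (jac_e k \<alpha> \<beta>) * jacobi (k + 1) \<alpha> \<beta> z"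
proof -
  consider "k = 0 \<and> \<alpha> = -1 \<and> \<beta> = -1" | "k = 1 \<and> \<alpha> = -1 \<and> \<beta> = -1"
    | n where "k = int n" "\<not> ((n = 0 \<or> n = 1) \<and> \<alpha> = -1 \<and> \<beta> = -1)"
    using assms(3) by (metis nat_0_le of_nat_0 of_nat_1)
  then show ?thesis
  proof cases
    case 1
    then show ?thesis by (simp add: jac_e_def jacobi_1_exceptional field_simps)
  next
    case 2
    then show ?thesis
      by (simp add: jac_e_def jacobi_1 jacobi_1_exceptional jacobi_2_exceptional field_simps)
  next
    case (3 n)
    let ?u = "(z - 1) / 2"
    have d: "0 < 2 * real n + \<alpha> + \<beta> + 2"
    proof (cases "n = 0")
      case True then show ?thesis using assms 3 by auto
    next
      case False then have "1 \<le> real n" by simp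
      then show ?thesis using assms by simp
    qed
    have i: "int n + 1 = int (Suc n)" by simp
    have "(real n + \<alpha> + 1) * jacobi k \<alpha> \<beta> z - (real n + 1) * jacobi (k + 1) \<alpha> \<beta> z
       = (\<Sum>j\<le>Suc n. ((real n + \<alpha> + 1) * jacobi_coeff n \<alpha> \<beta> j
            - (real n + 1) * jacobi_coeff (Suc n) \<alpha> \<beta> j) * ?u ^ j)"
    proof -
      have "jacobi k \<alpha> \<beta> z = (\<Sum>j\<le>Suc n. jacobi_coeff n \<alpha> \<beta> j * ?u ^ j)"
        unfolding 3(1) using 3(2) by (intro jacobi_expansion) auto
      moreover have "jacobi (k + 1) \<alpha> \<beta> z = (\<Sum>j\<le>Suc n. jacobi_coeff (Suc n) \<alpha> \<beta> j * ?u ^ j)"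
        unfolding 3(1) i using 3(2) by (intro jacobi_expansion) auto
      ultimately show ?thesis
        by (simp only: sum_distrib_left sum_subtractf [symmetric] left_diff_distrib mult.assoc)
    qed
    also have "\<dots> = (\<Sum>j\<le>n. - (2 * real n + \<alpha> + \<beta> + 2) * jacobi_coeff n (\<alpha> + 1) \<beta> j * ?u ^ Suc j)"
      by (subst sum.atMost_Suc_shift)
         (simp only: jacobi_coeff_weighted_0 jacobi_coeff_weighted_Suc, simp)
    also have "\<dots> = (2 * real n + \<alpha> + \<beta> + 2) * ((1 - z) / 2 * jacobi k (\<alpha> + 1) \<beta> z)"
      using assms 3
      by (simp add: jacobi_expansion[of n "\<alpha> + 1" \<beta> n] sum_distrib_left sum_distrib_right)
         (auto intro!: sum.cong simp: field_simps)
    finally have "(1 - z) / 2 * jacobi k (\<alpha> + 1) \<beta> z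
        = (real n + \<alpha> + 1) / (2 * real n + \<alpha> + \<beta> + 2) * jacobi k \<alpha> \<beta> z
          + - ((real n + 1) / (2 * real n + \<alpha> + \<beta> + 2)) * jacobi (k + 1) \<alpha> \<beta> z"
      using d by (intro eq_scaled_sum) auto
    moreover have "jac_e k \<alpha> \<beta> = ((real n + \<alpha> + 1) / (2 * real n + \<alpha> + \<beta> + 2),
        - ((real n + 1) / (2 * real n + \<alpha> + \<beta> + 2)))"
      using 3 by (auto simp: jac_e_def)
    ultimately show ?thesis by simp
  qed
qed

text \<open>The coefficients obtained by raising the first parameter and lowering it again, after the
  substitution \<open>z = 1 - 2 (1 - z) / 2\<close>. This one formula covers all the exceptional values in the
  definition of the \<open>a\<close> coefficients; at \<open>k = 0\<close> the terms with index \<open>k - 1\<close> are multiplied by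
  \<open>b\<^sub>2 = 0\<close>.\<close>
lemma jac_a_factorization:
  assumes "-1 \<le> \<alpha>" "-1 \<le> \<beta>" "0 \<le> k"
  shows "jac_a k \<alpha> \<beta> =
    (- 2 * fst (jac_b k \<alpha> \<beta>) * snd (jac_e k \<alpha> \<beta>),
     1 - 2 * (fst (jac_b k \<alpha> \<beta>) * fst (jac_e k \<alpha> \<beta>) + snd (jac_b k \<alpha> \<beta>) * snd (jac_e (k - 1) \<alpha> \<beta>)),
     - 2 * snd (jac_b k \<alpha> \<beta>) * fst (jac_e (k - 1) \<alpha> \<beta>))"
proof -
  consider "k = 0 \<and> \<alpha> = -1 \<and> \<beta> = -1" | "k = 1 \<and> \<alpha> = -1 \<and> \<beta> = -1" | "k = 2 \<and> \<alpha> = -1 \<and> \<beta> = -1"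
    | "k = 0 \<and> \<not> (\<alpha> = -1 \<and> \<beta> = -1)" | "1 \<le> k" "\<not> ((k = 1 \<or> k = 2) \<and> \<alpha> = -1 \<and> \<beta> = -1)"
    using assms(3) by linarith
  then show ?thesis
  proof cases
    case 4
    then have s: "\<alpha> + \<beta> + 2 \<noteq> 0" using assms by auto
    have "1 - 2 * ((\<alpha> + 1) / (\<alpha> + \<beta> + 2)) = (\<beta> - \<alpha>) / (\<alpha> + \<beta> + 2)"
      using s by (simp add: divide_simps)
    then show ?thesis using 4 s by (auto simp: jac_a_def jac_b_def jac_e_def)
  next
    case 5
    define x :: real where "x = of_int k"
    have d: "0 < 2 * x + \<alpha> + \<beta>"
    proof (cases "k = 1")
      case True then show ?thesis using assms 5 by (auto simp: x_def)
    next
      case False then have "2 \<le> k" using 5 by linarith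
      then have "2 \<le> x" by (simp add: x_def)
      then show ?thesis using assms by simp
    qed
    define s where "s = 2 * x + \<alpha> + \<beta>"
    have n: "s \<noteq> 0" "s + 1 \<noteq> 0" "s + 2 \<noteq> 0" using d by (simp_all add: s_def)
    have a: "jac_a k \<alpha> \<beta> = (2 * (x + 1) * (x + \<alpha> + \<beta> + 1) / ((s + 1) * (s + 2)),
        (\<beta>\<^sup>2 - \<alpha>\<^sup>2) / (s * (s + 2)), 2 * (x + \<alpha>) * (x + \<beta>) / (s * (s + 1)))"
      using 5 by (auto simp: jac_a_def x_def s_def)
    have b: "jac_b k \<alpha> \<beta> = ((x + \<alpha> + \<beta> + 1) / (s + 1), - ((x + \<beta>) / (s + 1)))"
      using 5 by (auto simp: jac_b_def x_def s_def)
    have e: "jac_e k \<alpha> \<beta> = ((x + \<alpha> + 1) / (s + 2), - ((x + 1) / (s + 2)))"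
      using 5 by (auto simp: jac_e_def x_def s_def)
    have e': "jac_e (k - 1) \<alpha> \<beta> = ((x + \<alpha>) / s, - (x / s))"
      using 5 by (auto simp: jac_e_def x_def s_def)
    have "(\<beta>\<^sup>2 - \<alpha>\<^sup>2) / (s * (s + 2)) = 1 - 2 * ((x + \<alpha> + \<beta> + 1) / (s + 1) * ((x + \<alpha> + 1) / (s + 2))
        + - ((x + \<beta>) / (s + 1)) * - (x / s))"
    proof -
      have "s * (s + 1) * (s + 2) - 2 * ((x + \<alpha> + \<beta> + 1) * (x + \<alpha> + 1) * s + (x + \<beta>) * x * (s + 2))
          = (\<beta>\<^sup>2 - \<alpha>\<^sup>2) * (s + 1)"
        by (simp add: s_def power2_eq_square algebra_simps)
      then show ?thesis using n by (simp add: divide_simps) (simp add: algebra_simps)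
    qed
    moreover have "2 * (x + 1) * (x + \<alpha> + \<beta> + 1) / ((s + 1) * (s + 2))
        = - 2 * ((x + \<alpha> + \<beta> + 1) / (s + 1)) * - ((x + 1) / (s + 2))"
      using n by (simp add: divide_simps) (simp add: algebra_simps)
    moreover have "2 * (x + \<alpha>) * (x + \<beta>) / (s * (s + 1))
        = - 2 * - ((x + \<beta>) / (s + 1)) * ((x + \<alpha>) / s)"
      using n by (simp add: divide_simps) (simp add: algebra_simps)
    ultimately show ?thesis unfolding a b e e' by simp
  qed (simp_all add: jac_a_def jac_b_def jac_e_def)
qed

lemma jacobi_three_term:
  assumes "-1 \<le> \<alpha>" "-1 \<le> \<beta>" "0 \<le> k"
  shows "z * jacobi k \<alpha> \<beta> z =
    fst (jac_a k \<alpha> \<beta>) * jacobi (k + 1) \<alpha> \<beta> z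
      + fst (snd (jac_a k \<alpha> \<beta>)) * jacobi k \<alpha> \<beta> z
      + snd (snd (jac_a k \<alpha> \<beta>)) * jacobi (k - 1) \<alpha> \<beta> z"
proof -
  let ?b1 = "fst (jac_b k \<alpha> \<beta>)" and ?b2 = "snd (jac_b k \<alpha> \<beta>)"
  let ?J = "\<lambda>k. jacobi k \<alpha> \<beta> z"
  let ?e1 = "\<lambda>k. fst (jac_e k \<alpha> \<beta>)" and ?e2 = "\<lambda>k. snd (jac_e k \<alpha> \<beta>)"
  have e: "(1 - z) / 2 * jacobi k (\<alpha> + 1) \<beta> z = ?e1 k * ?J k + ?e2 k * ?J (k + 1)"
    using assms by (rule jacobi_weighted_connection)
  have e': "?b2 * ((1 - z) / 2 * jacobi (k - 1) (\<alpha> + 1) \<beta> z)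
      = ?b2 * (?e1 (k - 1) * ?J (k - 1) + ?e2 (k - 1) * ?J k)"
  proof (cases "k = 0")
    case True then show ?thesis by (simp add: jac_b_def)
  next
    case False
    then show ?thesis using jacobi_weighted_connection[of \<alpha> \<beta> "k - 1" z] assms by simp
  qed
  have "(1 - z) / 2 * ?J k
      = ?b1 * ((1 - z) / 2 * jacobi k (\<alpha> + 1) \<beta> z) + ?b2 * ((1 - z) / 2 * jacobi (k - 1) (\<alpha> + 1) \<beta> z)"
    using jacobi_connection[OF assms(1,2), of k z] by (simp only: algebra_simps)
  then have "(1 - z) / 2 * ?J k = ?b1 * (?e1 k * ?J k + ?e2 k * ?J (k + 1))
      + ?b2 * (?e1 (k - 1) * ?J (k - 1) + ?e2 (k - 1) * ?J k)"
    unfolding e e' .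
  then show ?thesis unfolding jac_a_factorization[OF assms] by (simp add: field_simps)
qed

section \<open>Multiplication and shift of the first parameter\<close>
lemma sum_neg1_to_1: "(\<Sum>i::int=-1..1. f i) = f (-1) + f 0 + (f 1 :: 'a :: comm_monoid_add)"
proof -
  have "{-1..1::int} = {-1, 0, 1}"
    by (rule Set.set_eqI) (simp only: atLeastAtMost_iff insert_iff empty_iff, presburger)
  then show ?thesis by (simp add: add.assoc)
qed

lemma at3_prod: "at3 p x = (if p = -1 then fst x else if p = 0 then fst (snd x) else snd (snd x))"
  by (cases x rule: prod_cases3) simp

text \<open>The coefficients of \<open>(1 + z) / 2 \<cdot> J\<^sub>k\<close>; each Cartesian coordinate is a
  factor of this form times \<open>t1\<close>, \<open>t2\<close> or \<open>1\<close>.\<close>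
definition jac_mult :: "int \<Rightarrow> real \<Rightarrow> real \<Rightarrow> int \<Rightarrow> real" where
  "jac_mult k \<alpha> \<beta> p = (let (a1, a2, a3) = jac_a k \<alpha> \<beta> in 1 / 2 * at3 p (a1, 1 + a2, a3))"

text \<open>One table for the three expansions of \<open>((1 - z) / 2) ^ (q + 1) J\<^sub>k\<close> in polynomials with first
  parameter \<open>\<alpha> - 2 q\<close>, so that the two uses of it in the multivariate recurrences need no case
  distinction on \<open>q\<close>.\<close>
definition jac_shift :: "int \<Rightarrow> real \<Rightarrow> real \<Rightarrow> int \<Rightarrow> int \<Rightarrow> real" where
  "jac_shift k \<alpha> \<beta> q r = (let (a1, a2, a3) = jac_a k \<alpha> \<beta> in
    at3 r (at3 q (jac_c k \<alpha> \<beta>, (- a1 / 2, (1 - a2) / 2, - a3 / 2), jac_g k (\<alpha> - 2) \<beta>)))"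

lemma jacobi_mult:
  assumes "-1 \<le> \<alpha>" "-1 \<le> \<beta>" "0 \<le> k"
  shows "(1 + z) / 2 * jacobi k \<alpha> \<beta> z = (\<Sum>p=-1..1. jac_mult k \<alpha> \<beta> p * jacobi (k - p) \<alpha> \<beta> z)"
proof -
  have "(1 + z) / 2 * jacobi k \<alpha> \<beta> z = 1 / 2 * (jacobi k \<alpha> \<beta> z + z * jacobi k \<alpha> \<beta> z)"
    by (simp add: algebra_simps)
  then show ?thesis
    unfolding jacobi_three_term[OF assms]
    by (simp add: sum_neg1_to_1 jac_mult_def split_beta at3_prod) (simp add: algebra_simps)
qed

text \<open>For \<open>q = -1\<close> the first parameter is raised twice, for \<open>q = 0\<close> this is the three-term recurrence,
  and for \<open>q = 1\<close> each of the two factors \<open>(1 - z) / 2\<close> lowers the parameter once. Lowering must not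
  leave the range \<open>\<ge> -1\<close>, whence the condition \<open>\<alpha> \<ge> 1\<close> for \<open>q = 1\<close>.\<close>
lemma jacobi_shift:
  assumes "-1 \<le> \<alpha>" "-1 \<le> \<beta>" "0 \<le> k" "q \<in> {-1..1}" "q = 1 \<Longrightarrow> 1 \<le> \<alpha>"
  shows "((1 - z) / 2) ^ nat (q + 1) * jacobi k \<alpha> \<beta> z =
    (\<Sum>r=-1..1. jac_shift k \<alpha> \<beta> q r * jacobi (k - (r - q)) (\<alpha> - 2 * of_int q) \<beta> z)"
proof -
  have "q = -1 \<or> q = 0 \<or> q = 1" using assms(4) unfolding atLeastAtMost_iff by linarith
  then show ?thesis
  proof (elim disjE)
    assume 1: "q = -1"
    have \<beta>: "-1 \<le> \<alpha> + 1" using assms(1) by simp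
    have i: "\<alpha> + 1 + 1 = \<alpha> + 2" "k - 1 - 1 = k - 2" by simp_all
    note b = jacobi_connection[OF assms(1,2), of k z]
      jacobi_connection[OF \<beta> assms(2), of k z, unfolded i]
      jacobi_connection[OF \<beta> assms(2), of "k - 1" z, unfolded i]
    have "jacobi k \<alpha> \<beta> z = fst (jac_c k \<alpha> \<beta>) * jacobi k (\<alpha> + 2) \<beta> z
        + fst (snd (jac_c k \<alpha> \<beta>)) * jacobi (k - 1) (\<alpha> + 2) \<beta> z
        + snd (snd (jac_c k \<alpha> \<beta>)) * jacobi (k - 2) (\<alpha> + 2) \<beta> z"
      unfolding b jac_c_def Let_def fst_conv snd_conv by (simp only: algebra_simps)
    then show ?thesis
      unfolding 1 by (simp add: sum_neg1_to_1 jac_shift_def split_beta at3_prod)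
  next
    assume 2: "q = 0"
    have "(1 - z) / 2 * jacobi k \<alpha> \<beta> z = 1 / 2 * (jacobi k \<alpha> \<beta> z - z * jacobi k \<alpha> \<beta> z)"
      by (simp add: field_simps)
    then show ?thesis
      unfolding jacobi_three_term[OF assms(1-3)] 2
      by (simp add: sum_neg1_to_1 jac_shift_def split_beta at3_prod) (simp add: algebra_simps)
  next
    assume 3: "q = 1"
    let ?t = "(1 - z) / 2"
    have \<alpha>: "-1 \<le> \<alpha> - 1" "-1 \<le> \<alpha> - 2" using assms(5)[OF 3] by simp_all
    have k: "0 \<le> k + 1" using assms(3) by simp
    have i: "\<alpha> - 1 + 1 = \<alpha>" "\<alpha> - 2 + 1 = \<alpha> - 1" "k + 1 + 1 = k + 2" by simp_all
    note e = jacobi_weighted_connection[OF \<alpha>(1) assms(2) assms(3), of z, unfolded i]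
      jacobi_weighted_connection[OF \<alpha>(2) assms(2) assms(3), of z, unfolded i]
      jacobi_weighted_connection[OF \<alpha>(2) assms(2) k, of z, unfolded i]
    have "?t ^ 2 * jacobi k \<alpha> \<beta> z = fst (jac_e k (\<alpha> - 1) \<beta>) * (?t * jacobi k (\<alpha> - 1) \<beta> z)
        + snd (jac_e k (\<alpha> - 1) \<beta>) * (?t * jacobi (k + 1) (\<alpha> - 1) \<beta> z)"
      unfolding power2_eq_square mult.assoc e(1) by (simp only: algebra_simps)
    also have "\<dots> = fst (jac_g k (\<alpha> - 2) \<beta>) * jacobi (k + 2) (\<alpha> - 2) \<beta> z
        + fst (snd (jac_g k (\<alpha> - 2) \<beta>)) * jacobi (k + 1) (\<alpha> - 2) \<beta> z
        + snd (snd (jac_g k (\<alpha> - 2) \<beta>)) * jacobi k (\<alpha> - 2) \<beta> z"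
      unfolding e(2,3) jac_g_def Let_def fst_conv snd_conv i by (simp only: algebra_simps)
    finally show ?thesis
      unfolding 3 by (simp add: sum_neg1_to_1 jac_shift_def split_beta at3_prod)
  qed
qed


section \<open>The three recurrences\<close>

text \<open>A Jacobi polynomial of negative degree is zero, so the product covers indices of either sign.\<close>
lemma koornwinder_eq_product:
  "koornwinder (\<alpha>0, \<alpha>1, \<alpha>2, \<alpha>3) (l1, l2, l3) (x1, x2, x3) =
    (1 - x2 - x3) ^ nat l1 * jacobi l1 \<alpha>0 \<alpha>1 (2 * x1 / (1 - x2 - x3) - 1)
      * ((1 - x3) ^ nat l2 * jacobi l2 (2 * of_int l1 + \<alpha>0 + \<alpha>1 + 1) \<alpha>2 (2 * x2 / (1 - x3) - 1))
      * jacobi l3 (2 * of_int l1 + 2 * of_int l2 + \<alpha>0 + \<alpha>1 + \<alpha>2 + 2) \<alpha>3 (2 * x3 - 1)"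
  by simp

lemma koorn_C1_factor:
  "koorn_C1 (l1, l2, l3) (\<alpha>0, \<alpha>1, \<alpha>2, \<alpha>3) r =
    jac_mult l3 (2 * of_int l1 + 2 * of_int l2 + \<alpha>0 + \<alpha>1 + \<alpha>2 + 2) \<alpha>3 r"
proof -
  have B: "2 * of_int (l1 + l2) + (\<alpha>0 + \<alpha>1 + \<alpha>2) + 2 = 2 * of_int l1 + 2 * of_int l2 + \<alpha>0 + \<alpha>1 + \<alpha>2 + 2"
    by simp
  show ?thesis unfolding koorn_C1.simps Let_def B jac_mult_def ..
qed

text \<open>The shift table has the factor \<open>1 / 2\<close> built in at \<open>q = 0\<close> only.\<close>
lemma koorn_T_factor:
  "koorn_T (l1, l2, l3) (\<alpha>0, \<alpha>1, \<alpha>2, \<alpha>3) q r = (if q = 0 then 1 else 1 / 2) *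
    jac_shift l3 (2 * of_int l1 + 2 * of_int l2 + \<alpha>0 + \<alpha>1 + \<alpha>2 + 2) \<alpha>3 q r"
proof -
  have B: "2 * of_int (l1 + l2) + (\<alpha>0 + \<alpha>1 + \<alpha>2) + 2 = 2 * of_int l1 + 2 * of_int l2 + \<alpha>0 + \<alpha>1 + \<alpha>2 + 2"
    by simp
  show ?thesis unfolding koorn_T.simps Let_def B jac_shift_def
    by (simp add: split_beta at3_prod)
qed

lemma koorn_C2_factor:
  "koorn_C2 (l1, l2, l3) (\<alpha>0, \<alpha>1, \<alpha>2, \<alpha>3) q r =
    jac_mult l2 (2 * of_int l1 + \<alpha>0 + \<alpha>1 + 1) \<alpha>2 q
      * jac_shift l3 (2 * of_int l1 + 2 * of_int l2 + \<alpha>0 + \<alpha>1 + \<alpha>2 + 2) \<alpha>3 q r"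
  unfolding koorn_C2.simps koorn_T_factor Let_def jac_mult_def
  by (simp add: split_beta at3_prod add.assoc)

text \<open>The three factors belong to the three steps in the proof of \<open>koornwinder_mult_x1\<close>: multiplication in
  the first factor, and one shift in each of the other two.\<close>
lemma koorn_C3_factor:
  "koorn_C3 (l1, l2, l3) (\<alpha>0, \<alpha>1, \<alpha>2, \<alpha>3) p q r =
    jac_mult l1 \<alpha>0 \<alpha>1 p
      * jac_shift l2 (2 * of_int l1 + \<alpha>0 + \<alpha>1 + 1) \<alpha>2 p q
      * jac_shift l3 (2 * of_int l1 + 2 * of_int l2 + \<alpha>0 + \<alpha>1 + \<alpha>2 + 2) \<alpha>3 q r"
proof -
  have A: "2 * of_int l1 + (\<alpha>0 + \<alpha>1) + 1 = 2 * of_int l1 + \<alpha>0 + \<alpha>1 + 1" by simp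
  show ?thesis
    unfolding koorn_C3.simps koorn_T_factor Let_def jac_mult_def A
      jac_shift_def[of l2 "2 * of_int l1 + \<alpha>0 + \<alpha>1 + 1" \<alpha>2]
    by (simp add: split_beta at3_prod)
qed

text \<open>On the face \<open>t1 = 0\<close> of the tetrahedron \<open>x1 = 0\<close>, and at \<open>t2 = 0\<close> also \<open>x2 = 0\<close>. So each identity reads
  \<open>0 = 0\<close> where its quotient is undefined, whatever value the quotient is given. In the last identity
  the factor \<open>1\<close> gives the same shape \<open>s = t (1 - z) / 2\<close> as in the identity for \<open>t1\<close>, for use in
  \<open>homogeneous_shift\<close>.\<close>
lemma tetrahedron_collapsed_coordinates:
  assumes "(x1, x2, x3) \<in> ref_tetrahedron"
  defines "t1 \<equiv> 1 - x2 - x3" and "t2 \<equiv> 1 - x3"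
  shows "x1 = t1 * ((1 + (2 * x1 / t1 - 1)) / 2)"
    and "x2 = t2 * ((1 + (2 * x2 / t2 - 1)) / 2)"
    and "x3 = (1 + (2 * x3 - 1)) / 2"
    and "t1 = t2 * ((1 - (2 * x2 / t2 - 1)) / 2)"
    and "t2 = 1 * ((1 - (2 * x3 - 1)) / 2)"
proof -
  have "t1 = 0 \<Longrightarrow> x1 = 0" "t2 = 0 \<Longrightarrow> x2 = 0"
    using assms by (auto simp: ref_tetrahedron_def)
  moreover have t: "t1 = t2 - x2" by (simp add: t1_def t2_def)
  moreover have "u = t * ((1 + (2 * u / t - 1)) / 2)" if "t = 0 \<Longrightarrow> u = 0" for u t :: real
    using that by (cases "t = 0") simp_all
  moreover have "t * ((1 + (2 * u / t - 1)) / 2) + t * ((1 - (2 * u / t - 1)) / 2) = t" for u t :: real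
    by (simp add: field_simps)
  ultimately show "x1 = t1 * ((1 + (2 * x1 / t1 - 1)) / 2)"
    "x2 = t2 * ((1 + (2 * x2 / t2 - 1)) / 2)" "t1 = t2 * ((1 - (2 * x2 / t2 - 1)) / 2)"
    by (metis add_diff_cancel_left')+
qed (simp_all add: t2_def)

text \<open>A surplus \<open>s ^ (q + 1)\<close> splits into \<open>t ^ (q + 1)\<close>, which is passed on to the next factor of the
  Koornwinder polynomial, and \<open>((1 - z) / 2) ^ (q + 1)\<close>, which the shift absorbs.\<close>
lemma homogeneous_shift:
  assumes "-1 \<le> \<alpha>" "-1 \<le> \<beta>" "0 \<le> k" "q \<in> {-1..1}" "q = 1 \<Longrightarrow> 1 \<le> \<alpha>"
    and s: "s = t * ((1 - z) / 2)" and "0 \<le> m" "n = m + q + 1"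
  shows "s ^ nat n * jacobi k \<alpha> \<beta> z =
    (\<Sum>r=-1..1. jac_shift k \<alpha> \<beta> q r *
      (s ^ nat m * t ^ nat (q + 1) * jacobi (k - (r - q)) (\<alpha> - 2 * of_int q) \<beta> z))"
proof -
  have "nat n = nat m + nat (q + 1)"
    using assms(4,7,8) by (simp add: nat_add_distrib[symmetric] add.assoc)
  then have "s ^ nat n = s ^ nat m * t ^ nat (q + 1) * ((1 - z) / 2) ^ nat (q + 1)"
    by (simp only: power_add s power_mult_distrib mult.assoc)
  then have e: "s ^ nat n * jacobi k \<alpha> \<beta> z =
      s ^ nat m * t ^ nat (q + 1) * (((1 - z) / 2) ^ nat (q + 1) * jacobi k \<alpha> \<beta> z)"
    by (simp only: mult.assoc)
  have j: "((1 - z) / 2) ^ nat (q + 1) * jacobi k \<alpha> \<beta> z =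
    (\<Sum>r=-1..1. jac_shift k \<alpha> \<beta> q r * jacobi (k - (r - q)) (\<alpha> - 2 * of_int q) \<beta> z)"
    using assms(1-5) by (rule jacobi_shift)
  show ?thesis
    unfolding e j sum_distrib_left
    by (intro sum.cong refl) (simp only: mult.left_commute)
qed

lemma koornwinder_mult_x3:
  assumes "-1 \<le> \<alpha>0" "-1 \<le> \<alpha>1" "-1 \<le> \<alpha>2" "-1 \<le> \<alpha>3" "0 \<le> l1" "0 \<le> l2" "0 \<le> l3"
  shows "x3 * koornwinder (\<alpha>0, \<alpha>1, \<alpha>2, \<alpha>3) (l1, l2, l3) (x1, x2, x3) =
    (\<Sum>r=-1..1. koorn_C1 (l1, l2, l3) (\<alpha>0, \<alpha>1, \<alpha>2, \<alpha>3) r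
      * koornwinder (\<alpha>0, \<alpha>1, \<alpha>2, \<alpha>3) (l1, l2, l3 - r) (x1, x2, x3))"
proof -
  define B where "B = 2 * of_int l1 + 2 * of_int l2 + \<alpha>0 + \<alpha>1 + \<alpha>2 + 2"
  have B: "-1 \<le> B" using assms by (simp add: B_def)
  have x3: "(1 + (2 * x3 - 1)) / 2 = x3" by simp
  note m = jacobi_mult[OF B \<open>-1 \<le> \<alpha>3\<close> \<open>0 \<le> l3\<close>, of "2 * x3 - 1", unfolded x3]
  show ?thesis
    unfolding koornwinder_eq_product koorn_C1_factor B_def[symmetric] mult.left_commute[of x3] m
      sum_distrib_left
    by (intro sum.cong refl) (simp only: mult_ac)
qed

lemma koornwinder_mult_x2:
  assumes "-1 \<le> \<alpha>0" "-1 \<le> \<alpha>1" "-1 \<le> \<alpha>2" "-1 \<le> \<alpha>3" "0 \<le> l1" "0 \<le> l2" "0 \<le> l3"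
    and x: "(x1, x2, x3) \<in> ref_tetrahedron"
  shows "x2 * koornwinder (\<alpha>0, \<alpha>1, \<alpha>2, \<alpha>3) (l1, l2, l3) (x1, x2, x3) =
    (\<Sum>q=-1..1. \<Sum>r=-1..1. koorn_C2 (l1, l2, l3) (\<alpha>0, \<alpha>1, \<alpha>2, \<alpha>3) q r
      * koornwinder (\<alpha>0, \<alpha>1, \<alpha>2, \<alpha>3) (l1, l2 - q, l3 - (r - q)) (x1, x2, x3))"
proof -
  define A where "A = 2 * of_int l1 + \<alpha>0 + \<alpha>1 + 1"
  define B where "B = 2 * of_int l1 + 2 * of_int l2 + \<alpha>0 + \<alpha>1 + \<alpha>2 + 2"
  define t2 where "t2 = 1 - x3"
  define w where "w = 2 * x2 / t2 - 1"
  define z where "z = 2 * x3 - 1"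
  define U where "U = (1 - x2 - x3) ^ nat l1 * jacobi l1 \<alpha>0 \<alpha>1 (2 * x1 / (1 - x2 - x3) - 1)"
  note defs = A_def[symmetric] B_def[symmetric] t2_def[symmetric] w_def[symmetric] z_def[symmetric] U_def[symmetric]
  have A: "-1 \<le> A" and B: "-1 \<le> B" using assms by (simp_all add: A_def B_def)
  have x2: "x2 = t2 * ((1 + w) / 2)" and t2: "t2 = 1 * ((1 - z) / 2)"
    unfolding t2_def w_def z_def by (intro tetrahedron_collapsed_coordinates[OF x])+
  have step: "t2 ^ nat (l2 + 1) * jacobi (l2 - q) A \<alpha>2 w * jacobi l3 B \<alpha>3 z =
      (\<Sum>r=-1..1. jac_shift l3 B \<alpha>3 q r *
        (t2 ^ nat (l2 - q) * jacobi (l2 - q) A \<alpha>2 w * jacobi (l3 - (r - q)) (B - 2 * of_int q) \<alpha>3 z))"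
    if q: "q \<in> {-1..1}" for q
  proof (cases "l2 - q < 0")
    case False
    \<comment> \<open>A term with \<open>q = 1\<close> and \<open>l2 - q \<ge> 0\<close> has \<open>l2 \<ge> 1\<close>, so lowering \<open>B\<close> by \<open>2\<close> stays in range.\<close>
    have "1 \<le> B" if "q = 1"
    proof -
      have "1 \<le> real_of_int l2" using False that by simp
      then show ?thesis using assms by (simp add: B_def)
    qed
    then have "t2 ^ nat (l2 + 1) * jacobi l3 B \<alpha>3 z =
      (\<Sum>r=-1..1. jac_shift l3 B \<alpha>3 q r *
        (t2 ^ nat (l2 - q) * 1 ^ nat (q + 1) * jacobi (l3 - (r - q)) (B - 2 * of_int q) \<alpha>3 z))"
      using False assms q by (intro homogeneous_shift B t2) auto
    then have "jacobi (l2 - q) A \<alpha>2 w * (t2 ^ nat (l2 + 1) * jacobi l3 B \<alpha>3 z) =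
        jacobi (l2 - q) A \<alpha>2 w * (\<Sum>r=-1..1. jac_shift l3 B \<alpha>3 q r *
        (t2 ^ nat (l2 - q) * jacobi (l3 - (r - q)) (B - 2 * of_int q) \<alpha>3 z))"
      by (simp only: power_one mult_1_right)
    then show ?thesis
      by (simp only: sum_distrib_left mult_ac)
  qed simp
  have "x2 * koornwinder (\<alpha>0, \<alpha>1, \<alpha>2, \<alpha>3) (l1, l2, l3) (x1, x2, x3)
      = U * (t2 ^ nat (l2 + 1) * jacobi l3 B \<alpha>3 z * ((1 + w) / 2 * jacobi l2 A \<alpha>2 w))"
    unfolding koornwinder_eq_product defs
    using assms(6) by (subst x2) (simp add: nat_add_distrib)
  also have "\<dots> = (\<Sum>q=-1..1. jac_mult l2 A \<alpha>2 q *
      (U * (t2 ^ nat (l2 + 1) * jacobi (l2 - q) A \<alpha>2 w * jacobi l3 B \<alpha>3 z)))"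
    unfolding jacobi_mult[OF A assms(3,6)] sum_distrib_left
    by (intro sum.cong refl) (simp only: mult_ac)
  also have "\<dots> = (\<Sum>q=-1..1. \<Sum>r=-1..1. koorn_C2 (l1, l2, l3) (\<alpha>0, \<alpha>1, \<alpha>2, \<alpha>3) q r
      * koornwinder (\<alpha>0, \<alpha>1, \<alpha>2, \<alpha>3) (l1, l2 - q, l3 - (r - q)) (x1, x2, x3))"
  proof (intro sum.cong refl, goal_cases)
    case (1 q)
    have b: "2 * of_int l1 + 2 * of_int (l2 - q) + \<alpha>0 + \<alpha>1 + \<alpha>2 + 2 = B - 2 * of_int q"
      by (simp add: B_def)
    show ?case
      unfolding step[OF 1] koornwinder_eq_product koorn_C2_factor b defs sum_distrib_left
      by (intro sum.cong refl) (simp only: mult_ac)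
  qed
  finally show ?thesis .
qed

text \<open>Terms in which a shifted index is negative have to be set aside before each shift: for them the
  required lower bound on the first parameter may fail, but both sides contain a Jacobi polynomial of
  negative degree and vanish.\<close>
lemma koornwinder_mult_x1:
  assumes "-1 \<le> \<alpha>0" "-1 \<le> \<alpha>1" "-1 \<le> \<alpha>2" "-1 \<le> \<alpha>3" "0 \<le> l1" "0 \<le> l2" "0 \<le> l3"
    and x: "(x1, x2, x3) \<in> ref_tetrahedron"
  shows "x1 * koornwinder (\<alpha>0, \<alpha>1, \<alpha>2, \<alpha>3) (l1, l2, l3) (x1, x2, x3) =
    (\<Sum>p=-1..1. \<Sum>q=-1..1. \<Sum>r=-1..1. koorn_C3 (l1, l2, l3) (\<alpha>0, \<alpha>1, \<alpha>2, \<alpha>3) p q r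
      * koornwinder (\<alpha>0, \<alpha>1, \<alpha>2, \<alpha>3) (l1 - p, l2 - (q - p), l3 - (r - q)) (x1, x2, x3))"
proof -
  define A where "A = 2 * of_int l1 + \<alpha>0 + \<alpha>1 + 1"
  define B where "B = 2 * of_int l1 + 2 * of_int l2 + \<alpha>0 + \<alpha>1 + \<alpha>2 + 2"
  define t1 where "t1 = 1 - x2 - x3"
  define t2 where "t2 = 1 - x3"
  define y where "y = 2 * x1 / t1 - 1"
  define w where "w = 2 * x2 / t2 - 1"
  define z where "z = 2 * x3 - 1"
  note defs = A_def[symmetric] B_def[symmetric] t1_def[symmetric] t2_def[symmetric]
    y_def[symmetric] w_def[symmetric] z_def[symmetric]
  have A: "-1 \<le> A" and B: "-1 \<le> B" using assms by (simp_all add: A_def B_def)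
  have x1: "x1 = t1 * ((1 + y) / 2)" and t1: "t1 = t2 * ((1 - w) / 2)" and t2: "t2 = 1 * ((1 - z) / 2)"
    unfolding t1_def t2_def y_def w_def z_def by (intro tetrahedron_collapsed_coordinates[OF x])+
  have step1: "t1 ^ nat (l1 + 1) * jacobi (l1 - p) \<alpha>0 \<alpha>1 y * jacobi l2 A \<alpha>2 w =
      (\<Sum>q=-1..1. jac_shift l2 A \<alpha>2 p q *
        (t1 ^ nat (l1 - p) * jacobi (l1 - p) \<alpha>0 \<alpha>1 y *
          (t2 ^ nat (p + 1) * jacobi (l2 - (q - p)) (A - 2 * of_int p) \<alpha>2 w)))"
    if p: "p \<in> {-1..1}" for p
  proof (cases "l1 - p < 0")
    case False
    have "1 \<le> A" if "p = 1"
    proof -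
      have "1 \<le> real_of_int l1" using False that by simp
      then show ?thesis using assms by (simp add: A_def)
    qed
    then have "t1 ^ nat (l1 + 1) * jacobi l2 A \<alpha>2 w =
      (\<Sum>q=-1..1. jac_shift l2 A \<alpha>2 p q *
        (t1 ^ nat (l1 - p) * t2 ^ nat (p + 1) * jacobi (l2 - (q - p)) (A - 2 * of_int p) \<alpha>2 w))"
      using False assms p by (intro homogeneous_shift A t1) auto
    then have "jacobi (l1 - p) \<alpha>0 \<alpha>1 y * (t1 ^ nat (l1 + 1) * jacobi l2 A \<alpha>2 w) =
      jacobi (l1 - p) \<alpha>0 \<alpha>1 y * (\<Sum>q=-1..1. jac_shift l2 A \<alpha>2 p q *
        (t1 ^ nat (l1 - p) * t2 ^ nat (p + 1) * jacobi (l2 - (q - p)) (A - 2 * of_int p) \<alpha>2 w))"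
      by (simp only:)
    then show ?thesis
      by (simp only: sum_distrib_left mult_ac)
  qed simp
  have step2: "jacobi (l1 - p) \<alpha>0 \<alpha>1 y * (t2 ^ nat (l2 + p + 1) * jacobi (l2 - (q - p)) (A - 2 * of_int p) \<alpha>2 w
        * jacobi l3 B \<alpha>3 z) =
      (\<Sum>r=-1..1. jac_shift l3 B \<alpha>3 q r *
        (jacobi (l1 - p) \<alpha>0 \<alpha>1 y * (t2 ^ nat (l2 - (q - p)) * jacobi (l2 - (q - p)) (A - 2 * of_int p) \<alpha>2 w
          * jacobi (l3 - (r - q)) (B - 2 * of_int q) \<alpha>3 z)))"
    if p: "p \<in> {-1..1}" and q: "q \<in> {-1..1}" for p q
  proof (cases "l2 - (q - p) < 0 \<or> l1 - p < 0")
    case False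
    have "1 \<le> B" if "q = 1"
    proof -
      have "1 \<le> l1 + l2" using False that by simp
      then have "1 \<le> real_of_int (l1 + l2)" by linarith
      then show ?thesis using assms by (simp add: B_def)
    qed
    then have "t2 ^ nat (l2 + p + 1) * jacobi l3 B \<alpha>3 z =
      (\<Sum>r=-1..1. jac_shift l3 B \<alpha>3 q r *
        (t2 ^ nat (l2 - (q - p)) * 1 ^ nat (q + 1) * jacobi (l3 - (r - q)) (B - 2 * of_int q) \<alpha>3 z))"
      using False assms q by (intro homogeneous_shift B t2) auto
    then have "jacobi (l1 - p) \<alpha>0 \<alpha>1 y * jacobi (l2 - (q - p)) (A - 2 * of_int p) \<alpha>2 w
          * (t2 ^ nat (l2 + p + 1) * jacobi l3 B \<alpha>3 z) =
        jacobi (l1 - p) \<alpha>0 \<alpha>1 y * jacobi (l2 - (q - p)) (A - 2 * of_int p) \<alpha>2 w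
          * (\<Sum>r=-1..1. jac_shift l3 B \<alpha>3 q r *
            (t2 ^ nat (l2 - (q - p)) * jacobi (l3 - (r - q)) (B - 2 * of_int q) \<alpha>3 z))"
      by (simp only: power_one mult_1_right)
    then show ?thesis
      by (simp only: sum_distrib_left mult_ac)
  qed auto
  have "x1 * koornwinder (\<alpha>0, \<alpha>1, \<alpha>2, \<alpha>3) (l1, l2, l3) (x1, x2, x3)
      = t1 ^ nat (l1 + 1) * jacobi l2 A \<alpha>2 w * (t2 ^ nat l2 * jacobi l3 B \<alpha>3 z) * ((1 + y) / 2 * jacobi l1 \<alpha>0 \<alpha>1 y)"
    unfolding koornwinder_eq_product defs
    using assms(5) by (subst x1) (simp add: nat_add_distrib)
  also have "\<dots> = (\<Sum>p=-1..1. jac_mult l1 \<alpha>0 \<alpha>1 p * (t2 ^ nat l2 * jacobi l3 B \<alpha>3 z) *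
      (t1 ^ nat (l1 + 1) * jacobi (l1 - p) \<alpha>0 \<alpha>1 y * jacobi l2 A \<alpha>2 w))"
    unfolding jacobi_mult[OF assms(1,2,5)] sum_distrib_left
    by (intro sum.cong refl) (simp only: mult_ac)
  also have "\<dots> = (\<Sum>p=-1..1. \<Sum>q=-1..1. jac_mult l1 \<alpha>0 \<alpha>1 p * jac_shift l2 A \<alpha>2 p q * t1 ^ nat (l1 - p)
      * (jacobi (l1 - p) \<alpha>0 \<alpha>1 y
        * (t2 ^ nat (l2 + p + 1) * jacobi (l2 - (q - p)) (A - 2 * of_int p) \<alpha>2 w * jacobi l3 B \<alpha>3 z)))"
  proof (intro sum.cong refl, goal_cases)
    case (1 p)
    have "nat (l2 + p + 1) = nat l2 + nat (p + 1)"
      using assms(6) 1 by (simp add: nat_add_distrib[symmetric] add.assoc)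
    then show ?case
      unfolding step1[OF 1] sum_distrib_left
      by (simp only: power_add mult_ac)
  qed
  also have "\<dots> = (\<Sum>p=-1..1. \<Sum>q=-1..1. \<Sum>r=-1..1. koorn_C3 (l1, l2, l3) (\<alpha>0, \<alpha>1, \<alpha>2, \<alpha>3) p q r
      * koornwinder (\<alpha>0, \<alpha>1, \<alpha>2, \<alpha>3) (l1 - p, l2 - (q - p), l3 - (r - q)) (x1, x2, x3))"
  proof (intro sum.cong refl, goal_cases)
    case (1 p q)
    have a: "2 * of_int (l1 - p) + \<alpha>0 + \<alpha>1 + 1 = A - 2 * of_int p"
      by (simp add: A_def)
    have b: "2 * of_int (l1 - p) + 2 * of_int (l2 - (q - p)) + \<alpha>0 + \<alpha>1 + \<alpha>2 + 2 = B - 2 * of_int q"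
      by (simp add: B_def)
    show ?case
      unfolding step2[OF 1] koornwinder_eq_product koorn_C3_factor a b defs sum_distrib_left
      by (intro sum.cong refl) (simp only: mult_ac)
  qed
  finally show ?thesis .
qed


section \<open>Linear independence\<close>

text \<open>The leading coefficient \<open>(k + \<alpha> + \<beta> + 1)\<^sub>k / k!\<close> is positive except for \<open>k = 1\<close>, \<open>\<alpha> = \<beta> = -1\<close>,
  and there the exceptional value \<open>J\<^sub>1 = z = 1 + 2 (z - 1) / 2\<close> has the right degree.\<close>
lemma jacobi_exact_degree:
  assumes "-1 \<le> \<alpha>" "-1 \<le> \<beta>"
  obtains h where "h k \<noteq> 0"
    and "\<And>n z. k \<le> n \<Longrightarrow> jacobi (int k) \<alpha> \<beta> z = (\<Sum>j\<le>n. h j * ((z - 1) / 2) ^ j)"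
    and "\<And>j. k < j \<Longrightarrow> h j = 0"
proof (cases "k = 1 \<and> \<alpha> = -1 \<and> \<beta> = -1")
  case True
  define h :: "nat \<Rightarrow> real" where "h j = (if j = 0 then 1 else if j = 1 then 2 else 0)" for j
  have "jacobi (int k) \<alpha> \<beta> z = (\<Sum>j\<le>n. h j * ((z - 1) / 2) ^ j)" if "k \<le> n" for n z
  proof -
    have "(\<Sum>j\<le>n. h j * ((z - 1) / 2) ^ j) = (\<Sum>j\<in>{0, 1}. h j * ((z - 1) / 2) ^ j)"
      using that True by (intro sum.mono_neutral_right) (auto simp: h_def)
    then show ?thesis using True by (simp add: h_def jacobi_1_exceptional diff_divide_distrib)
  qed
  then show ?thesis using that[of h] True by (simp add: h_def)
next
  case False
  have "0 < pochhammer (real k + \<alpha> + \<beta> + 1) k"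
  proof (cases "k = 0")
    case k: False
    have "0 < real k + \<alpha> + \<beta> + 1"
    proof (cases "k = 1")
      case True then show ?thesis using False assms by auto
    next
      case False then have "2 \<le> k" using k by simp
      then have "2 \<le> real k" by simp
      then show ?thesis using assms by simp
    qed
    then show ?thesis by (rule pochhammer_pos)
  qed simp
  then have "jacobi_coeff k \<alpha> \<beta> k \<noteq> 0" by (simp add: jacobi_coeff_def)
  then show ?thesis
    using jacobi_expansion[OF False] by (rule that) (simp_all add: jacobi_coeff_def)
qed

text \<open>In a vanishing combination only the polynomial of highest degree contributes to the
  leading power; its coefficient is therefore zero, and induction on the degree disposes of the others.\<close>
lemma jacobi_independent:
  assumes "-1 \<le> \<alpha>" "-1 \<le> \<beta>"
    and "\<And>z. -1 < z \<Longrightarrow> z < 1 \<Longrightarrow> (\<Sum>k\<le>n. c k * jacobi (int k) \<alpha> \<beta> z) = 0"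
    and "k \<le> n"
  shows "c k = 0"
  using assms(3,4)
proof (induction n arbitrary: k)
  case 0
  then show ?case using "0.prems"(1)[of 0] by simp
next
  case (Suc n)
  have "\<exists>h. \<forall>k. h k k \<noteq> 0 \<and> (\<forall>n z. k \<le> n \<longrightarrow> jacobi (int k) \<alpha> \<beta> z = (\<Sum>j\<le>n. h k j * ((z - 1) / 2) ^ j))
      \<and> (\<forall>j>k. h k j = 0)"
    by (intro choice allI) (metis jacobi_exact_degree[OF assms(1,2)])
  then obtain h where h: "\<And>k. h k k \<noteq> 0" "\<And>k j. k < j \<Longrightarrow> h k j = 0"
    "\<And>k n z. k \<le> n \<Longrightarrow> jacobi (int k) \<alpha> \<beta> z = (\<Sum>j\<le>n. h k j * ((z - 1) / 2) ^ j)"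
    by blast
  define C where "C j = (\<Sum>k\<le>Suc n. c k * h k j)" for j
  have C: "(\<Sum>j\<le>Suc n. C j * ((z - 1) / 2) ^ j) = (\<Sum>k\<le>Suc n. c k * jacobi (int k) \<alpha> \<beta> z)" for z
  proof -
    have "(\<Sum>k\<le>Suc n. c k * jacobi (int k) \<alpha> \<beta> z)
        = (\<Sum>k\<le>Suc n. \<Sum>j\<le>Suc n. c k * (h k j * ((z - 1) / 2) ^ j))"
      unfolding sum_distrib_left [symmetric]
      by (intro sum.cong refl arg_cong2[where f = times] h(3)) simp
    also have "\<dots> = (\<Sum>j\<le>Suc n. C j * ((z - 1) / 2) ^ j)"
      unfolding C_def sum_distrib_right mult.assoc by (rule sum.swap)
    finally show ?thesis by simp
  qed
  have "C (Suc n) = 0"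
  proof (rule ccontr)
    assume "C (Suc n) \<noteq> 0"
    then have "finite {u. (\<Sum>j\<le>Suc n. C j * u ^ j) = 0}"
      using polyfun_rootbound[of C "Suc n" "Suc n"] by simp
    moreover have "{-1<..<0} \<subseteq> {u. (\<Sum>j\<le>Suc n. C j * u ^ j) = 0}"
    proof
      fix u :: real assume "u \<in> {-1<..<0}"
      then have "(\<Sum>k\<le>Suc n. c k * jacobi (int k) \<alpha> \<beta> (2 * u + 1)) = 0"
        by (intro Suc.prems(1)) auto
      then show "u \<in> {u. (\<Sum>j\<le>Suc n. C j * u ^ j) = 0}"
        using C[of "2 * u + 1"] by simp
    qed
    ultimately have "finite {-1<..<0::real}" by (rule finite_subset[rotated])
    then show False using infinite_Ioo[of "-1 :: real" 0] by simp
  qed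
  moreover have "C (Suc n) = c (Suc n) * h (Suc n) (Suc n)"
    unfolding C_def by (simp add: h(2))
  ultimately have top: "c (Suc n) = 0" using h(1) by simp
  show ?case
  proof (cases "k = Suc n")
    case False
    have "(\<Sum>k\<le>n. c k * jacobi (int k) \<alpha> \<beta> z) = 0" if "-1 < z" "z < 1" for z
      using Suc.prems(1)[OF that] top by simp
    then show ?thesis using Suc.IH False Suc.prems(2) by simp
  qed (simp add: top)
qed

text \<open>For \<open>y, w, z\<close> in the open interval \<open>(-1, 1)\<close> the point lies in the tetrahedron and \<open>t1, t2\<close> are nonzero,
  so the coordinates can be varied independently. The parameters of the inner factors depend only on
  the outer indices; hence independence in \<open>y\<close> isolates \<open>l1\<close>, then independence in \<open>w\<close> isolates \<open>l2\<close>, and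
  independence in \<open>z\<close> isolates \<open>l3\<close>.\<close>
lemma koornwinder_independent_box:
  assumes "-1 \<le> \<alpha>0" "-1 \<le> \<alpha>1" "-1 \<le> \<alpha>2" "-1 \<le> \<alpha>3"
    and zero: "\<And>x. x \<in> ref_tetrahedron \<Longrightarrow> (\<Sum>l1\<le>n. \<Sum>l2\<le>n. \<Sum>l3\<le>n.
      c l1 l2 l3 * koornwinder (\<alpha>0, \<alpha>1, \<alpha>2, \<alpha>3) (int l1, int l2, int l3) x) = 0"
    and "l1 \<le> n" "l2 \<le> n" "l3 \<le> n"
  shows "c l1 l2 l3 = 0"
proof -
  define A where "A l1 = 2 * real l1 + \<alpha>0 + \<alpha>1 + 1" for l1
  define B where "B l1 l2 = 2 * real l1 + 2 * real l2 + \<alpha>0 + \<alpha>1 + \<alpha>2 + 2" for l1 l2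
  have A: "-1 \<le> A l1" and B: "-1 \<le> B l1 l2" for l1 l2
    using assms(1-4) by (simp_all add: A_def B_def)
  have expand: "(\<Sum>l1\<le>n. ((1 - z) / 2 * ((1 - w) / 2)) ^ l1 * (\<Sum>l2\<le>n. ((1 - z) / 2) ^ l2 * (\<Sum>l3\<le>n.
      c l1 l2 l3 * jacobi (int l3) (B l1 l2) \<alpha>3 z) * jacobi (int l2) (A l1) \<alpha>2 w) * jacobi (int l1) \<alpha>0 \<alpha>1 y) = 0"
    if "-1 < y" "y < 1" "-1 < w" "w < 1" "-1 < z" "z < 1" for y w z
  proof -
    define x3 where "x3 = (1 + z) / 2"
    define t2 where "t2 = (1 - z) / 2"
    define x2 where "x2 = t2 * ((1 + w) / 2)"
    define t1 where "t1 = t2 * ((1 - w) / 2)"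
    define x1 where "x1 = t1 * ((1 + y) / 2)"
    have pos: "0 < t2" "0 < t1" using that by (simp_all add: t2_def t1_def)
    have t2: "1 - x3 = t2" by (simp add: x3_def t2_def field_simps)
    have t1: "1 - x2 - x3 = t1"
    proof -
      have "1 - x2 - x3 = t2 - x2" using t2 by simp
      then show ?thesis by (simp add: t1_def x2_def field_simps)
    qed
    have coords: "2 * x1 / t1 - 1 = y" "2 * x2 / t2 - 1 = w" "2 * x3 - 1 = z"
      using pos by (simp_all add: x1_def x2_def x3_def add_divide_distrib)
    have "x1 \<le> t1 * 1" unfolding x1_def using pos that by (intro mult_left_mono) auto
    then have "x1 + x2 + x3 \<le> 1" using t1 by simp
    moreover have "0 \<le> x1" "0 \<le> x2" "0 \<le> x3"
      using pos that by (simp_all add: x1_def x2_def x3_def)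
    ultimately have "(x1, x2, x3) \<in> ref_tetrahedron" by (simp add: ref_tetrahedron_def)
    from zero[OF this] show ?thesis
      unfolding koornwinder_eq_product t1 t2 coords t2_def[symmetric] t1_def[symmetric]
      by (simp add: A_def B_def sum_distrib_left sum_distrib_right mult_ac)
  qed
  have "((1 - z) / 2) ^ l2 * (\<Sum>l3\<le>n. c l1 l2 l3 * jacobi (int l3) (B l1 l2) \<alpha>3 z) = 0"
    if z: "-1 < z" "z < 1" for z
  proof (rule jacobi_independent[OF A[of l1] assms(3) _ \<open>l2 \<le> n\<close>])
    fix w :: real assume w: "-1 < w" "w < 1"
    have "((1 - z) / 2 * ((1 - w) / 2)) ^ l1 * (\<Sum>l2\<le>n. ((1 - z) / 2) ^ l2 * (\<Sum>l3\<le>n.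
      c l1 l2 l3 * jacobi (int l3) (B l1 l2) \<alpha>3 z) * jacobi (int l2) (A l1) \<alpha>2 w) = 0"
      using expand[OF _ _ w z] by (rule jacobi_independent[OF assms(1,2) _ \<open>l1 \<le> n\<close>])
    then show "(\<Sum>l2\<le>n. ((1 - z) / 2) ^ l2 * (\<Sum>l3\<le>n.
      c l1 l2 l3 * jacobi (int l3) (B l1 l2) \<alpha>3 z) * jacobi (int l2) (A l1) \<alpha>2 w) = 0"
      using w z by simp
  qed
  then have "(\<Sum>l3\<le>n. c l1 l2 l3 * jacobi (int l3) (B l1 l2) \<alpha>3 z) = 0" if "-1 < z" "z < 1" for z
    using that by simp
  then show ?thesis by (rule jacobi_independent[OF B assms(4) _ \<open>l3 \<le> n\<close>])
qed

lemma koornwinder_independent: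
  assumes \<alpha>: "\<alpha> \<in> {-1..} \<times> {-1..} \<times> {-1..} \<times> {-1..}"
    and "finite S"
    and zero: "\<And>x. x \<in> ref_tetrahedron \<Longrightarrow>
      (\<Sum>(l1, l2, l3)\<in>S. c (l1, l2, l3) * koornwinder \<alpha> (int l1, int l2, int l3) x) = 0"
    and "l \<in> S"
  shows "c l = 0"
proof -
  obtain \<alpha>0 \<alpha>1 \<alpha>2 \<alpha>3 where a: "\<alpha> = (\<alpha>0, \<alpha>1, \<alpha>2, \<alpha>3)" by (rule prod_cases4)
  obtain n where n: "S \<subseteq> {..n} \<times> {..n} \<times> {..n}"
  proof -
    let ?M = "\<lambda>(a, b, c). a + b + c :: nat"
    have "S \<subseteq> {..Max (?M ` S)} \<times> {..Max (?M ` S)} \<times> {..Max (?M ` S)}"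
    proof
      fix s assume s: "s \<in> S"
      then have "?M s \<le> Max (?M ` S)" using \<open>finite S\<close> by simp
      then show "s \<in> {..Max (?M ` S)} \<times> {..Max (?M ` S)} \<times> {..Max (?M ` S)}"
        by (cases s) auto
    qed
    then show ?thesis by (rule that)
  qed
  define c' where "c' l1 l2 l3 = (if (l1, l2, l3) \<in> S then c (l1, l2, l3) else 0)" for l1 l2 l3
  obtain l1 l2 l3 where l: "l = (l1, l2, l3)" by (rule prod_cases3)
  have "c' l1 l2 l3 = 0"
  proof (rule koornwinder_independent_box)
    show "-1 \<le> \<alpha>0" "-1 \<le> \<alpha>1" "-1 \<le> \<alpha>2" "-1 \<le> \<alpha>3" using \<alpha> by (simp_all add: a)
    show "l1 \<le> n" "l2 \<le> n" "l3 \<le> n" using n \<open>l \<in> S\<close> by (auto simp: l)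
    fix x assume x: "x \<in> ref_tetrahedron"
    have "(\<Sum>l1\<le>n. \<Sum>l2\<le>n. \<Sum>l3\<le>n. c' l1 l2 l3 * koornwinder (\<alpha>0, \<alpha>1, \<alpha>2, \<alpha>3) (int l1, int l2, int l3) x)
      = (\<Sum>(l1, l2, l3)\<in>{..n} \<times> {..n} \<times> {..n}. c' l1 l2 l3 * koornwinder \<alpha> (int l1, int l2, int l3) x)"
      by (simp add: a sum.cartesian_product)
    also have "\<dots> = (\<Sum>(l1, l2, l3)\<in>S. c (l1, l2, l3) * koornwinder \<alpha> (int l1, int l2, int l3) x)"
      using n by (intro sum.mono_neutral_cong_right) (auto simp: c'_def)
    finally show "(\<Sum>l1\<le>n. \<Sum>l2\<le>n. \<Sum>l3\<le>n. c' l1 l2 l3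
        * koornwinder (\<alpha>0, \<alpha>1, \<alpha>2, \<alpha>3) (int l1, int l2, int l3) x) = 0"
      using zero[OF x] by simp
  qed
  then show ?thesis using \<open>l \<in> S\<close> by (simp add: c'_def l)
qed


section \<open>Triangular block indexing\<close>
definition block_offset :: "nat \<Rightarrow> nat \<Rightarrow> nat" where
  "block_offset n k = (\<Sum>i<k. n - i)"

text \<open>A position \<open>(k, a)\<close> at level \<open>n\<close> stands for the index \<open>(k, a, n - 1 - k - a)\<close> of total degree \<open>n - 1\<close>.
  Counting levels by \<open>n\<close> rather than by the degree includes the empty level of degree \<open>-1\<close>.\<close>
definition block_positions :: "nat \<Rightarrow> (nat \<times> nat) set" where
  "block_positions n = (SIGMA k:{..<n}. {..<n - k})"

definition flat_index :: "nat \<Rightarrow> nat \<times> nat \<Rightarrow> nat" where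
  "flat_index n = (\<lambda>(k, a). block_offset n k + a)"

lemma block_offset_Suc: "block_offset n (Suc k) = block_offset n k + (n - k)"
  by (simp add: block_offset_def)

lemma block_offset_mono: "k \<le> k' \<Longrightarrow> block_offset n k \<le> block_offset n k'"
  unfolding block_offset_def by (intro sum_mono2) auto

lemma flat_index_less:
  assumes "k < K" "a < n - k"
  shows "flat_index n (k, a) < block_offset n K"
  using block_offset_mono[of "Suc k" K n] assms by (simp add: flat_index_def block_offset_Suc)

lemma flat_index_surj:
  assumes "i < block_offset n K"
  obtains k a where "k < K" "a < n - k" "i = flat_index n (k, a)"
proof -
  have "\<exists>k a. k < K \<and> a < n - k \<and> i = flat_index n (k, a)"
    using assms
  proof (induction K)
    case 0
    then show ?case by (simp add: block_offset_def)
  next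
    case (Suc K)
    show ?case
    proof (cases "i < block_offset n K")
      case True
      then show ?thesis using Suc.IH less_SucI by blast
    next
      case False
      then have "i = flat_index n (K, i - block_offset n K)" "i - block_offset n K < n - K"
        using Suc.prems by (auto simp: flat_index_def block_offset_Suc)
      then show ?thesis by blast
    qed
  qed
  then show ?thesis using that by blast
qed

lemma inj_on_flat_index: "inj_on (flat_index n) (block_positions n)"
proof -
  have less: "flat_index n (k, a) < flat_index n (k', a')" if "k < k'" "a < n - k" for k k' a a'
    using flat_index_less[OF that] by (simp add: flat_index_def)
  show ?thesis
  proof (rule inj_onI, clarsimp simp: block_positions_def)
    fix k a k' a'
    assume *: "flat_index n (k, a) = flat_index n (k', a')" "k < n" "k' < n" "a < n - k" "a' < n - k'"
    have "k = k'"
      using less[of k k' a a'] less[of k' k a' a] * by (cases k k' rule: linorder_cases) auto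
    then show "k = k' \<and> a = a'" using *(1) by (simp add: flat_index_def)
  qed
qed

lemma bij_betw_flat_index: "bij_betw (flat_index n) (block_positions n) {..<block_offset n n}"
  unfolding bij_betw_def
proof (intro conjI inj_on_flat_index Set.set_eqI iffI)
  fix i assume "i \<in> {..<block_offset n n}"
  then show "i \<in> flat_index n ` block_positions n"
    by (auto simp: block_positions_def elim!: flat_index_surj)
qed (auto simp: block_positions_def intro: flat_index_less)

lemma finite_block_positions [simp]: "finite (block_positions n)"
  by (simp add: block_positions_def)

text \<open>Both sides count the monomials of degree \<open>n - 1\<close> in three variables; the induction is Pascal's rule.\<close>
lemma koorn_dim_eq_offset: "koorn_dim (int n - 1) = block_offset n n"
proof (cases n)
  case (Suc m)
  have "block_offset (Suc m) (Suc m) = (m + 2) choose m"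
  proof (induction m)
    case 0
    then show ?case by (simp add: block_offset_def)
  next
    case (Suc m)
    have "block_offset (Suc (Suc m)) (Suc (Suc m)) = m + 2 + block_offset (Suc m) (Suc m)"
      by (simp add: block_offset_def sum.lessThan_Suc_shift[of _ "Suc m"] del: sum.lessThan_Suc)
    also have "\<dots> = (Suc m + 2) choose Suc m"
      using Suc.IH by (simp add: numeral_2_eq_2)
    finally show ?case .
  qed
  then show ?thesis by (simp add: koorn_dim_def Suc nat_add_distrib)
qed (simp add: koorn_dim_def block_offset_def)

lemma concat_triangular:
  assumes "K \<le> n"
  shows "length (concat (map (\<lambda>k. map (f k) [0..<n - k]) [0..<K])) = block_offset n K"
    and "k < K \<Longrightarrow> a < n - k \<Longrightarrow>
      concat (map (\<lambda>k. map (f k) [0..<n - k]) [0..<K]) ! flat_index n (k, a) = f k a"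
proof -
  have len: "length (concat (map (\<lambda>k. map (f k) [0..<n - k]) [0..<K])) = block_offset n K" for K
    by (induction K) (simp_all add: block_offset_def)
  then show "length (concat (map (\<lambda>k. map (f k) [0..<n - k]) [0..<K])) = block_offset n K" .
  show "concat (map (\<lambda>k. map (f k) [0..<n - k]) [0..<K]) ! flat_index n (k, a) = f k a"
    if "k < K" "a < n - k"
    using that(1)
  proof (induction K)
    case (Suc K)
    show ?case
    proof (cases "k = K")
      case True
      then show ?thesis using that(2) by (simp add: nth_append len flat_index_def)
    next
      case False
      then show ?thesis
        using Suc flat_index_less[of k K a n] that(2) by (simp add: nth_append len)
    qed
  qed simp
qed

lemma upto_conv_map_upt: "[0..int n - 1] = map int [0..<n]"
proof (induction n)
  case (Suc n)
  then show ?case using upto_rec2[of 0 "int n"] by simp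
qed simp

lemma koorn_vec_eq:
  "koorn_vec \<alpha> (int n - 1) x = vec_of_list (concat (map (\<lambda>k. map (\<lambda>a.
     koornwinder \<alpha> (int k, int a, int n - 1 - int k - int a) x) [0..<n - k]) [0..<n]))"
proof -
  have row: "map (\<lambda>j. koornwinder \<alpha> (int k, j, int n - 1 - int k - j) x) [0..int n - 1 - int k]
      = map (\<lambda>a. koornwinder \<alpha> (int k, int a, int n - 1 - int k - int a) x) [0..<n - k]"
    if "k \<in> set [0..<n]" for k
  proof -
    have eq: "[0..int n - 1 - int k] = [0..int (n - k) - 1]" using that by (simp add: of_nat_diff algebra_simps)
    show ?thesis unfolding eq upto_conv_map_upt map_map comp_def ..
  qed
  show ?thesis
    unfolding koorn_vec_def upto_conv_map_upt map_map comp_def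
    by (intro arg_cong[where f = vec_of_list] arg_cong[where f = concat] map_cong refl row)
qed

lemma dim_koorn_vec: "dim_vec (koorn_vec \<alpha> (int n - 1) x) = block_offset n n"
  unfolding koorn_vec_eq dim_vec_of_list by (rule concat_triangular) simp

lemma koorn_vec_nth:
  assumes "(k, a) \<in> block_positions n"
  shows "koorn_vec \<alpha> (int n - 1) x $ flat_index n (k, a) =
    koornwinder \<alpha> (int k, int a, int n - 1 - int k - int a) x"
  using assms unfolding koorn_vec_eq vec_of_list_index
  by (intro concat_triangular) (auto simp: block_positions_def)

lemma mult_mat_vec_block_positions:
  assumes "dim_col M = block_offset n n" "dim_vec v = block_offset n n" "i < dim_row M"
  shows "(M *\<^sub>v v) $ i = (\<Sum>\<sigma>\<in>block_positions n. M $$ (i, flat_index n \<sigma>) * v $ flat_index n \<sigma>)"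
proof -
  have "(M *\<^sub>v v) $ i = (\<Sum>j\<in>{..<block_offset n n}. M $$ (i, j) * v $ j)"
    using assms by (simp add: scalar_prod_def lessThan_atLeast0)
  also have "\<dots> = (\<Sum>\<sigma>\<in>block_positions n. M $$ (i, flat_index n \<sigma>) * v $ flat_index n \<sigma>)"
    by (rule sum.reindex_bij_betw[OF bij_betw_flat_index, symmetric])
  finally show ?thesis .
qed

lemma index_mat_eq_index_block:
  assumes "a < p - k" "b < n - j"
  shows "M $$ (flat_index p (k, a), flat_index n (j, b)) = block p n M k j $$ (a, b)"
  using assms by (simp add: block_def flat_index_def block_offset_def)

text \<open>The inverse of the flattening lets a matrix be given by its entries at pairs of positions.\<close>
definition mat_of_blocks :: "nat \<Rightarrow> nat \<Rightarrow> (nat \<times> nat \<Rightarrow> nat \<times> nat \<Rightarrow> real) \<Rightarrow> real mat" where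
  "mat_of_blocks p n c = mat (block_offset p p) (block_offset n n)
    (\<lambda>(i, j). c (inv_into (block_positions p) (flat_index p) i) (inv_into (block_positions n) (flat_index n) j))"

lemma mat_of_blocks_carrier [simp]:
  "mat_of_blocks p n c \<in> carrier_mat (block_offset p p) (block_offset n n)"
  by (simp add: mat_of_blocks_def)

lemma index_mat_of_blocks:
  assumes "\<rho> \<in> block_positions p" "\<sigma> \<in> block_positions n"
  shows "mat_of_blocks p n c $$ (flat_index p \<rho>, flat_index n \<sigma>) = c \<rho> \<sigma>"
proof -
  have "flat_index p \<rho> < block_offset p p" "flat_index n \<sigma> < block_offset n n"
    using assms bij_betwE[OF bij_betw_flat_index] by blast+
  then show ?thesis
    using assms inv_into_f_f[OF inj_on_flat_index] by (simp add: mat_of_blocks_def)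
qed

lemma block_mat_of_blocks:
  assumes "k < p" "j < n"
  shows "block p n (mat_of_blocks p n c) k j = mat (p - k) (n - j) (\<lambda>(a, b). c (k, a) (j, b))"
proof (rule eq_matI)
  fix a b assume *: "a < dim_row (mat (p - k) (n - j) (\<lambda>(a, b). c (k, a) (j, b)))"
    "b < dim_col (mat (p - k) (n - j) (\<lambda>(a, b). c (k, a) (j, b)))"
  then have "block p n (mat_of_blocks p n c) k j $$ (a, b)
      = mat_of_blocks p n c $$ (flat_index p (k, a), flat_index n (j, b))"
    by (intro index_mat_eq_index_block[symmetric]) auto
  also have "\<dots> = c (k, a) (j, b)"
    using * assms by (intro index_mat_of_blocks) (auto simp: block_positions_def)
  finally show "block p n (mat_of_blocks p n c) k j $$ (a, b)
      = mat (p - k) (n - j) (\<lambda>(a, b). c (k, a) (j, b)) $$ (a, b)"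
    using * by simp
qed (simp_all add: block_def)


section \<open>The recurrences sorted by total degree\<close>
fun coord :: "nat \<Rightarrow> point \<Rightarrow> real" where
  "coord i (x1, x2, x3) = (if i = 1 then x1 else if i = 2 then x2 else x3)"

text \<open>Padding the coefficients for \<open>x2\<close> and \<open>x3\<close> with zeros gives the three recurrences one shape, a sum
  over \<open>p, q, r\<close>, so that the matrices can be built uniformly in the coordinate \<open>i\<close>.\<close>
definition koorn_coeff :: "nat \<Rightarrow> param \<Rightarrow> index \<Rightarrow> int \<Rightarrow> int \<Rightarrow> int \<Rightarrow> real" where
  "koorn_coeff i \<alpha> l p q r =
    (if i = 1 then koorn_C3 l \<alpha> p q r
     else if i = 2 then (if p = 0 then koorn_C2 l \<alpha> q r else 0)
     else (if p = 0 \<and> q = 0 then koorn_C1 l \<alpha> r else 0))"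

lemma koornwinder_mult_coord:
  assumes "\<alpha> \<in> {-1..} \<times> {-1..} \<times> {-1..} \<times> {-1..}" "l \<in> {0..} \<times> {0..} \<times> {0..}"
    and "x \<in> ref_tetrahedron"
  shows "coord i x * koornwinder \<alpha> l x =
    (\<Sum>p=-1..1. \<Sum>q=-1..1. \<Sum>r=-1..1.
      koorn_coeff i \<alpha> l p q r * koornwinder \<alpha> (l - (p, q - p, r - q)) x)"
proof -
  obtain \<alpha>0 \<alpha>1 \<alpha>2 \<alpha>3 where \<alpha>: "\<alpha> = (\<alpha>0, \<alpha>1, \<alpha>2, \<alpha>3)" by (rule prod_cases4)
  obtain l1 l2 l3 where l: "l = (l1, l2, l3)" by (rule prod_cases3)
  obtain x1 x2 x3 where x: "x = (x1, x2, x3)" by (rule prod_cases3)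
  have a: "-1 \<le> \<alpha>0" "-1 \<le> \<alpha>1" "-1 \<le> \<alpha>2" "-1 \<le> \<alpha>3" "0 \<le> l1" "0 \<le> l2" "0 \<le> l3"
    using assms by (simp_all add: \<alpha> l)
  consider "i = 1" | "i = 2" | "i \<noteq> 1" "i \<noteq> 2" by blast
  then show ?thesis
  proof cases
    case 1
    then show ?thesis
      using koornwinder_mult_x1[OF a assms(3)[unfolded x]] 
      by (simp add: \<alpha> l x koorn_coeff_def diff_Pair del: koornwinder.simps koorn_C3.simps)
  next
    case 2
    then show ?thesis
      using koornwinder_mult_x2[OF a assms(3)[unfolded x]]
      by (simp add: \<alpha> l x koorn_coeff_def diff_Pair sum_neg1_to_1 del: koornwinder.simps koorn_C2.simps)
  next
    case 3
    then show ?thesis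
      using koornwinder_mult_x3[OF a, of x3 x1 x2]
      by (simp add: \<alpha> l x koorn_coeff_def diff_Pair sum_neg1_to_1 del: koornwinder.simps koorn_C1.simps)
  qed
qed

text \<open>The coefficient with which position \<open>(j, b)\<close> of degree \<open>m - r\<close> enters the recurrence for position
  \<open>(k, a)\<close> of degree \<open>m\<close>. It solves \<open>j = k - p\<close>, \<open>b = a - (q - p)\<close> for \<open>p\<close> and \<open>q\<close>.\<close>
definition level_coeff ::
  "nat \<Rightarrow> param \<Rightarrow> nat \<Rightarrow> int \<Rightarrow> nat \<times> nat \<Rightarrow> nat \<times> nat \<Rightarrow> real" where
  "level_coeff i \<alpha> m r = (\<lambda>(k, a) (j, b).
    let p = int k - int j; q = p + int a - int b
    in if \<bar>p\<bar> \<le> 1 \<and> \<bar>q\<bar> \<le> 1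
       then koorn_coeff i \<alpha> (int k, int a, int m - int k - int a) p q r else 0)"

text \<open>The two sums run over the same terms, indexed by the position reached or by the shift \<open>(p, q)\<close>.
  Positions too far away have coefficient zero, and shifts that leave the index range carry a
  Koornwinder polynomial with a negative index.\<close>
lemma sum_level_coeff:
  assumes ka: "(k, a) \<in> block_positions (m + 1)" and n: "int n = int m + 1 - r"
  shows "(\<Sum>\<sigma>\<in>block_positions n. level_coeff i \<alpha> m r (k, a) \<sigma> * koorn_vec \<alpha> (int n - 1) x $ flat_index n \<sigma>) =
    (\<Sum>p=-1..1. \<Sum>q=-1..1. koorn_coeff i \<alpha> (int k, int a, int m - int k - int a) p q r
      * koornwinder \<alpha> ((int k, int a, int m - int k - int a) - (p, q - p, r - q)) x)"
    (is "sum ?g _ = (\<Sum>p=_.._. \<Sum>q=_.._. ?h p q)")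
proof -
  let ?to = "\<lambda>(j, b). (int k - int j, int k - int j + int a - int b)"
  let ?from = "\<lambda>(p, q). (nat (int k - p), nat (int a - q + p))"
  let ?range = "{-1..1::int} \<times> {-1..1::int}"
  let ?far = "{\<sigma> \<in> block_positions n. ?to \<sigma> \<notin> ?range}"
  let ?neg = "{(p, q) \<in> ?range. int k - p < 0 \<or> int a - q + p < 0 \<or> int m - int k - int a - r + q < 0}"
  let ?h' = "\<lambda>\<tau>. if \<tau> \<in> ?range then case \<tau> of (p, q) \<Rightarrow> ?h p q else 0"
  have "sum ?g (block_positions n) = sum ?h' ?range"
  proof (rule sum.reindex_bij_witness_not_neutral[where i = ?from and j = ?to and S' = ?far and T' = ?neg])
    show "finite ?far" by simp
    show "finite ?neg" by (rule finite_subset[of _ ?range]) auto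
  next
    fix \<sigma> assume "\<sigma> \<in> block_positions n - ?far"
    then show "?from (?to \<sigma>) = \<sigma>" "?to \<sigma> \<in> ?range - ?neg"
      using n by (auto simp: block_positions_def)
  next
    fix \<tau> assume "\<tau> \<in> ?range - ?neg"
    moreover obtain p q where pq: "\<tau> = (p, q)" by (cases \<tau>)
    ultimately have *: "0 \<le> int k - p" "0 \<le> int a - q + p" "0 \<le> int m - int k - int a - r + q" "(p, q) \<in> ?range"
      by auto
    from *(1,2) show "?to (?from \<tau>) = \<tau>" by (simp add: pq)
    with *(4) have "?to (?from \<tau>) \<in> ?range" by (simp add: pq)
    moreover have "?from \<tau> \<in> block_positions n"
      using * n by (auto simp: pq block_positions_def)
    ultimately show "?from \<tau> \<in> block_positions n - ?far" by blast
  next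
    fix \<sigma> assume "\<sigma> \<in> ?far"
    then have "level_coeff i \<alpha> m r (k, a) \<sigma> = 0"
      by (cases \<sigma>) (auto simp: level_coeff_def Let_def)
    then show "?g \<sigma> = 0" by simp
  next
    fix \<tau> assume "\<tau> \<in> ?neg"
    moreover obtain \<alpha>0 \<alpha>1 \<alpha>2 \<alpha>3 where "\<alpha> = (\<alpha>0, \<alpha>1, \<alpha>2, \<alpha>3)" by (rule prod_cases4)
    moreover obtain x1 x2 x3 where "x = (x1, x2, x3)" by (rule prod_cases3)
    ultimately show "?h' \<tau> = 0"
      by (cases \<tau>) auto
  next
    fix \<sigma> assume *: "\<sigma> \<in> block_positions n"
    obtain j b where jb: "\<sigma> = (j, b)" by (cases \<sigma>)
    have third: "int n - 1 - int j - int b = int m - int k - int a - (r - (int k - int j + int a - int b))"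
      using n by simp
    have "koorn_vec \<alpha> (int n - 1) x $ flat_index n \<sigma> = koornwinder \<alpha> ((int k, int a, int m - int k - int a)
        - (int k - int j, int k - int j + int a - int b - (int k - int j), r - (int k - int j + int a - int b))) x"
      using * unfolding jb by (subst koorn_vec_nth) (simp_all only: diff_Pair third, simp)
    then show "?h' (?to \<sigma>) = ?g \<sigma>"
      by (auto simp: jb level_coeff_def Let_def abs_le_iff)
  qed
  also have "\<dots> = (\<Sum>(p, q)\<in>?range. ?h p q)" by (intro sum.cong) auto
  finally show ?thesis by (simp only: sum.cartesian_product)
qed

text \<open>The part of the multiplication by the coordinate \<open>i\<close> that maps degree \<open>m\<close> to degree \<open>m - r = n - 1\<close>.\<close>
definition level_mat :: "nat \<Rightarrow> param \<Rightarrow> nat \<Rightarrow> int \<Rightarrow> nat \<Rightarrow> real mat" where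
  "level_mat i \<alpha> m r n = mat_of_blocks (Suc m) n (level_coeff i \<alpha> m r)"

text \<open>The part that preserves the degree, minus \<open>s\<close> times the identity.\<close>
definition shifted_level_mat :: "nat \<Rightarrow> param \<Rightarrow> nat \<Rightarrow> real \<Rightarrow> real mat" where
  "shifted_level_mat i \<alpha> m s = mat_of_blocks (Suc m) (Suc m)
    (\<lambda>\<rho> \<sigma>. level_coeff i \<alpha> m 0 \<rho> \<sigma> - (if \<rho> = \<sigma> then s else 0))"

lemma level_coeff_eq_0:
  "int k - int j \<notin> {-1..1} \<or> int k - int j + int a - int b \<notin> {-1..1} \<Longrightarrow>
    level_coeff i \<alpha> m r (k, a) (j, b) = 0"
  "i \<noteq> 1 \<Longrightarrow> k \<noteq> j \<Longrightarrow> level_coeff i \<alpha> m r (k, a) (j, b) = 0"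
  "i = 3 \<Longrightarrow> a \<noteq> b \<Longrightarrow> level_coeff i \<alpha> m r (k, a) (j, b) = 0"
  by (auto simp: level_coeff_def koorn_coeff_def Let_def)

lemma block_level_mat:
  "k < Suc m \<Longrightarrow> j < n \<Longrightarrow> block (Suc m) n (level_mat i \<alpha> m r n) k j =
    mat (Suc m - k) (n - j) (\<lambda>(a, b). level_coeff i \<alpha> m r (k, a) (j, b))"
  unfolding level_mat_def by (rule block_mat_of_blocks)

lemma block_shifted_level_mat:
  assumes "k < Suc m" "j < Suc m"
  shows "block (Suc m) (Suc m) (shifted_level_mat i \<alpha> m s) k j =
    (if j = k then block (Suc m) (Suc m) (level_mat i \<alpha> m 0 (Suc m)) k k - s \<cdot>\<^sub>m 1\<^sub>m (Suc m - k)
     else block (Suc m) (Suc m) (level_mat i \<alpha> m 0 (Suc m)) k j)"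
  unfolding shifted_level_mat_def block_mat_of_blocks[OF assms]
  using assms by (auto simp: block_level_mat intro!: eq_matI)

lemma level_mat_block_off_diagonal:
  assumes "k < Suc m" "j < n" "(k \<noteq> j \<and> k \<noteq> Suc j \<and> j \<noteq> Suc k) \<or> (i \<noteq> 1 \<and> k \<noteq> j)"
  shows "block (Suc m) n (level_mat i \<alpha> m r n) k j = 0\<^sub>m (Suc m - k) (n - j)"
proof -
  have "level_coeff i \<alpha> m r (k, a) (j, b) = 0" for a b
    using assms(3) by (auto intro: level_coeff_eq_0)
  then show ?thesis by (auto simp: block_level_mat assms)
qed

lemma block_carrier: "block p n M k j \<in> carrier_mat (p - k) (n - j)"
  by (simp add: block_def)

lemma level_mat_form:
  fixes m n r \<alpha>
  defines "blk \<equiv> \<lambda>i. block (Suc m) n (level_mat i \<alpha> m r n)"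
  shows "block_tridiagonal_form (Suc m) n (\<lambda>k. blk 1 k (k - 1)) (\<lambda>k. blk 1 k k) (\<lambda>k. blk 1 k (Suc k))
      (level_mat 1 \<alpha> m r n)"
    and "i \<noteq> 1 \<Longrightarrow> block_diagonal_form (Suc m) n (\<lambda>k. blk i k k) (level_mat i \<alpha> m r n)"
  unfolding block_tridiagonal_form_def block_diagonal_form_def blk_def
  by (auto intro!: level_mat_block_off_diagonal)

lemma shifted_level_mat_form:
  fixes m s \<alpha>
  defines "blk \<equiv> \<lambda>i. block (Suc m) (Suc m) (level_mat i \<alpha> m 0 (Suc m))"
  shows "block_tridiagonal_form (Suc m) (Suc m) (\<lambda>k. blk 1 k (k - 1))
      (\<lambda>k. blk 1 k k - s \<cdot>\<^sub>m 1\<^sub>m (Suc m - k)) (\<lambda>k. blk 1 k (Suc k)) (shifted_level_mat 1 \<alpha> m s)"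
    and "i \<noteq> 1 \<Longrightarrow> block_diagonal_form (Suc m) (Suc m)
      (\<lambda>k. blk i k k - s \<cdot>\<^sub>m 1\<^sub>m (Suc m - k)) (shifted_level_mat i \<alpha> m s)"
  unfolding block_tridiagonal_form_def block_diagonal_form_def blk_def
  by (auto simp: block_shifted_level_mat intro!: level_mat_block_off_diagonal)

text \<open>In a block with fixed \<open>p\<close>, the condition \<open>q \<in> {-1, 0, 1}\<close> confines \<open>a - b = q - p\<close> to three diagonals.
  For \<open>p = 0\<close> these are the central ones, for \<open>p = -1\<close> the lower and for \<open>p = 1\<close> the upper ones.\<close>
lemma level_mat_block_bands:
  assumes "k < Suc m"
  shows "k < n \<Longrightarrow> tridiagonal (block (Suc m) n (level_mat i \<alpha> m r n) k k)"
    and "k < n \<Longrightarrow> diagonal_mat (block (Suc m) n (level_mat 3 \<alpha> m r n) k k)"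
    and "Suc k < n \<Longrightarrow> lower_tridiagonal (block (Suc m) n (level_mat i \<alpha> m r n) k (Suc k))"
    and "0 < k \<Longrightarrow> k \<le> n \<Longrightarrow> upper_tridiagonal (block (Suc m) n (level_mat i \<alpha> m r n) k (k - 1))"
proof -
  have nonzero: "\<bar>int k - int j\<bar> \<le> 1 \<and> \<bar>int k - int j + int a - int b\<bar> \<le> 1"
    if "level_coeff i \<alpha> m r (k, a) (j, b) \<noteq> 0" for i a j b
    using that by (auto simp: level_coeff_def Let_def split: if_splits)
  show "tridiagonal (block (Suc m) n (level_mat i \<alpha> m r n) k k)" if "k < n"
    using nonzero[of i _ k] that assms by (force simp: tridiagonal_def block_level_mat)
  show "diagonal_mat (block (Suc m) n (level_mat 3 \<alpha> m r n) k k)" if "k < n"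
    using that assms by (auto simp: diagonal_mat_def block_level_mat level_coeff_eq_0(3))
  show "lower_tridiagonal (block (Suc m) n (level_mat i \<alpha> m r n) k (Suc k))" if "Suc k < n"
    using nonzero[of i _ "Suc k"] that assms by (force simp: lower_tridiagonal_def block_level_mat)
  show "upper_tridiagonal (block (Suc m) n (level_mat i \<alpha> m r n) k (k - 1))" if "0 < k" "k \<le> n"
    using nonzero[of i _ "k - 1"] that assms by (force simp: upper_tridiagonal_def block_level_mat of_nat_diff)
qed


lemma level_mat_carrier [simp]:
  "level_mat i \<alpha> m r n \<in> carrier_mat (block_offset (Suc m) (Suc m)) (block_offset n n)"
  "shifted_level_mat i \<alpha> m s \<in> carrier_mat (block_offset (Suc m) (Suc m)) (block_offset (Suc m) (Suc m))"
  by (simp_all add: level_mat_def shifted_level_mat_def)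

lemma level_mat_dim [simp]:
  "dim_row (level_mat i \<alpha> m r n) = block_offset (Suc m) (Suc m)"
  "dim_col (level_mat i \<alpha> m r n) = block_offset n n"
  "dim_row (shifted_level_mat i \<alpha> m s) = block_offset (Suc m) (Suc m)"
  "dim_col (shifted_level_mat i \<alpha> m s) = block_offset (Suc m) (Suc m)"
  using level_mat_carrier[of i \<alpha> m] by (auto simp del: level_mat_carrier)

lemma koorn_vec_carrier [simp]: "koorn_vec \<alpha> (int n - 1) x \<in> carrier_vec (block_offset n n)"
  by (rule carrier_vecI) (rule dim_koorn_vec)

lemma level_mat_mult_koorn_vec:
  assumes "(k, a) \<in> block_positions (Suc m)" and "int n = int m + 1 - r"
  shows "(level_mat i \<alpha> m r n *\<^sub>v koorn_vec \<alpha> (int n - 1) x) $ flat_index (Suc m) (k, a) =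
    (\<Sum>p=-1..1. \<Sum>q=-1..1. koorn_coeff i \<alpha> (int k, int a, int m - int k - int a) p q r
      * koornwinder \<alpha> ((int k, int a, int m - int k - int a) - (p, q - p, r - q)) x)"
proof -
  have "flat_index (Suc m) (k, a) < block_offset (Suc m) (Suc m)"
    using assms(1) bij_betwE[OF bij_betw_flat_index] by blast
  then have "(level_mat i \<alpha> m r n *\<^sub>v koorn_vec \<alpha> (int n - 1) x) $ flat_index (Suc m) (k, a) =
    (\<Sum>\<sigma>\<in>block_positions n. level_mat i \<alpha> m r n $$ (flat_index (Suc m) (k, a), flat_index n \<sigma>)
      * koorn_vec \<alpha> (int n - 1) x $ flat_index n \<sigma>)"
    by (intro mult_mat_vec_block_positions dim_koorn_vec) (simp_all add: level_mat_def mat_of_blocks_def)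
  also have "\<dots> = (\<Sum>\<sigma>\<in>block_positions n. level_coeff i \<alpha> m r (k, a) \<sigma> * koorn_vec \<alpha> (int n - 1) x $ flat_index n \<sigma>)"
    unfolding level_mat_def using assms(1) by (intro sum.cong refl) (simp add: index_mat_of_blocks)
  also have "\<dots> = (\<Sum>p=-1..1. \<Sum>q=-1..1. koorn_coeff i \<alpha> (int k, int a, int m - int k - int a) p q r
      * koornwinder \<alpha> ((int k, int a, int m - int k - int a) - (p, q - p, r - q)) x)"
    using assms by (intro sum_level_coeff) simp_all
  finally show ?thesis .
qed

lemma shifted_level_mat_mult_koorn_vec:
  assumes ka: "(k, a) \<in> block_positions (Suc m)"
  shows "(shifted_level_mat i \<alpha> m s *\<^sub>v koorn_vec \<alpha> (int m) x) $ flat_index (Suc m) (k, a) =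
    (\<Sum>p=-1..1. \<Sum>q=-1..1. koorn_coeff i \<alpha> (int k, int a, int m - int k - int a) p q 0
      * koornwinder \<alpha> ((int k, int a, int m - int k - int a) - (p, q - p, 0 - q)) x)
    - s * koornwinder \<alpha> (int k, int a, int m - int k - int a) x"
proof -
  have m: "int m = int (Suc m) - 1" by simp
  let ?n = "Suc m" let ?v = "koorn_vec \<alpha> (int ?n - 1) x"
  have v: "?v $ flat_index (Suc m) (k, a) = koornwinder \<alpha> (int k, int a, int m - int k - int a) x"
    using ka by (subst koorn_vec_nth) simp_all
  have "flat_index ?n (k, a) < block_offset ?n ?n"
    using ka bij_betwE[OF bij_betw_flat_index] by blast
  then have "(shifted_level_mat i \<alpha> m s *\<^sub>v ?v) $ flat_index ?n (k, a) =
    (\<Sum>\<sigma>\<in>block_positions ?n. shifted_level_mat i \<alpha> m s $$ (flat_index ?n (k, a), flat_index ?n \<sigma>)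
      * ?v $ flat_index ?n \<sigma>)"
    by (intro mult_mat_vec_block_positions dim_koorn_vec) (simp_all add: shifted_level_mat_def mat_of_blocks_def)
  also have "\<dots> = (\<Sum>\<sigma>\<in>block_positions ?n. level_coeff i \<alpha> m 0 (k, a) \<sigma> * ?v $ flat_index ?n \<sigma>
      - (if (k, a) = \<sigma> then s * ?v $ flat_index ?n (k, a) else 0))"
    unfolding shifted_level_mat_def using ka
    by (intro sum.cong refl) (auto simp: index_mat_of_blocks left_diff_distrib)
  also have "\<dots> = (\<Sum>\<sigma>\<in>block_positions ?n. level_coeff i \<alpha> m 0 (k, a) \<sigma> * ?v $ flat_index ?n \<sigma>)
      - s * ?v $ flat_index ?n (k, a)"
    using ka by (simp add: sum_subtractf sum.delta')
  also have "(\<Sum>\<sigma>\<in>block_positions ?n. level_coeff i \<alpha> m 0 (k, a) \<sigma> * ?v $ flat_index ?n \<sigma>)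
      = (\<Sum>p=-1..1. \<Sum>q=-1..1. koorn_coeff i \<alpha> (int k, int a, int m - int k - int a) p q 0
      * koornwinder \<alpha> ((int k, int a, int m - int k - int a) - (p, q - p, 0 - q)) x)"
    using ka by (intro sum_level_coeff) simp_all
  finally show ?thesis unfolding v by simp
qed

text \<open>Row by row this is the recurrence for the coordinate \<open>i\<close>, with its terms grouped by \<open>r\<close>.\<close>
lemma level_recurrence:
  assumes \<alpha>: "\<alpha> \<in> {-1..} \<times> {-1..} \<times> {-1..} \<times> {-1..}" and x: "x \<in> ref_tetrahedron"
  shows "level_mat i \<alpha> m (-1) (Suc (Suc m)) *\<^sub>v koorn_vec \<alpha> (int m + 1) x
      + shifted_level_mat i \<alpha> m (coord i x) *\<^sub>v koorn_vec \<alpha> (int m) x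
      + level_mat i \<alpha> m 1 m *\<^sub>v koorn_vec \<alpha> (int m - 1) x = 0\<^sub>v (block_offset (Suc m) (Suc m))"
    (is "?A *\<^sub>v ?u + ?B *\<^sub>v ?v + ?C *\<^sub>v ?w = 0\<^sub>v ?r")
proof (rule eq_vecI)
  show "dim_vec (?A *\<^sub>v ?u + ?B *\<^sub>v ?v + ?C *\<^sub>v ?w) = dim_vec (0\<^sub>v ?r :: real vec)"
    by simp
  fix row assume "row < dim_vec (0\<^sub>v ?r :: real vec)"
  then obtain k a where "k < Suc m" "a < Suc m - k" and row: "row = flat_index (Suc m) (k, a)"
    by (auto elim: flat_index_surj)
  then have ka: "(k, a) \<in> block_positions (Suc m)" and l: "(int k, int a, int m - int k - int a) \<in> {0..} \<times> {0..} \<times> {0..}"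
    by (auto simp: block_positions_def)
  have u: "?u = koorn_vec \<alpha> (int (Suc (Suc m)) - 1) x"
    by (rule arg_cong[where f = "\<lambda>n. koorn_vec \<alpha> n x"]) simp
  let ?f = "\<lambda>p q r. koorn_coeff i \<alpha> (int k, int a, int m - int k - int a) p q r
    * koornwinder \<alpha> ((int k, int a, int m - int k - int a) - (p, q - p, r - q)) x"
  have "(?A *\<^sub>v ?u + ?B *\<^sub>v ?v + ?C *\<^sub>v ?w) $ row = (?A *\<^sub>v ?u) $ row + (?B *\<^sub>v ?v) $ row + (?C *\<^sub>v ?w) $ row"
    using \<open>row < dim_vec (0\<^sub>v ?r :: real vec)\<close> by simp
  also have "(?A *\<^sub>v ?u) $ row = (\<Sum>p=-1..1. \<Sum>q=-1..1. ?f p q (-1))"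
    unfolding row u using ka by (intro level_mat_mult_koorn_vec) simp_all
  also have "(?C *\<^sub>v ?w) $ row = (\<Sum>p=-1..1. \<Sum>q=-1..1. ?f p q 1)"
    unfolding row using ka by (intro level_mat_mult_koorn_vec) simp_all
  also have "(?B *\<^sub>v ?v) $ row = (\<Sum>p=-1..1. \<Sum>q=-1..1. ?f p q 0)
      - coord i x * koornwinder \<alpha> (int k, int a, int m - int k - int a) x"
    unfolding row using ka by (rule shifted_level_mat_mult_koorn_vec)
  also have "coord i x * koornwinder \<alpha> (int k, int a, int m - int k - int a) x
      = (\<Sum>p=-1..1. \<Sum>q=-1..1. ?f p q (-1)) + (\<Sum>p=-1..1. \<Sum>q=-1..1. ?f p q 0)
        + (\<Sum>p=-1..1. \<Sum>q=-1..1. ?f p q 1)"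
    unfolding koornwinder_mult_coord[OF \<alpha> l x] sum_neg1_to_1[of "\<lambda>r. ?f _ _ r"] by (simp only: sum.distrib)
  finally show "(?A *\<^sub>v ?u + ?B *\<^sub>v ?v + ?C *\<^sub>v ?w) $ row = 0\<^sub>v ?r $ row"
    using \<open>row < dim_vec (0\<^sub>v ?r :: real vec)\<close> by simp
qed

lemma koorn_dim_level:
  "koorn_dim (int m) = block_offset (Suc m) (Suc m)"
  "koorn_dim (int m + 1) = block_offset (Suc (Suc m)) (Suc (Suc m))"
  "koorn_dim (int m - 1) = block_offset m m"
  using koorn_dim_eq_offset[of "Suc m"] koorn_dim_eq_offset[of "Suc (Suc m)"] koorn_dim_eq_offset[of m]
  by (simp_all add: add.commute)

section \<open>The stacked matrices and their block form\<close>
definition stacked_level_mat :: "param \<Rightarrow> nat \<Rightarrow> int \<Rightarrow> nat \<Rightarrow> real mat" where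
  "stacked_level_mat \<alpha> m r n = level_mat 1 \<alpha> m r n @\<^sub>r level_mat 2 \<alpha> m r n @\<^sub>r level_mat 3 \<alpha> m r n"

definition stacked_shifted_level_mat :: "param \<Rightarrow> nat \<Rightarrow> point \<Rightarrow> real mat" where
  "stacked_shifted_level_mat \<alpha> m x = shifted_level_mat 1 \<alpha> m (coord 1 x)
    @\<^sub>r shifted_level_mat 2 \<alpha> m (coord 2 x) @\<^sub>r shifted_level_mat 3 \<alpha> m (coord 3 x)"

lemma carrier_append_rows3:
  assumes "A1 \<in> carrier_mat d n" "A2 \<in> carrier_mat d n" "A3 \<in> carrier_mat d n"
  shows "A1 @\<^sub>r A2 @\<^sub>r A3 \<in> carrier_mat (3 * d) n"
proof -
  have "A1 @\<^sub>r A2 @\<^sub>r A3 \<in> carrier_mat (d + (d + d)) n" using assms by (intro carrier_append_rows)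
  moreover have "d + (d + d) = 3 * d" by simp
  ultimately show ?thesis by simp
qed

lemma stacked_carrier:
  "stacked_level_mat \<alpha> m r n \<in> carrier_mat (3 * block_offset (Suc m) (Suc m)) (block_offset n n)"
  "stacked_shifted_level_mat \<alpha> m x \<in> carrier_mat (3 * block_offset (Suc m) (Suc m)) (block_offset (Suc m) (Suc m))"
  unfolding stacked_level_mat_def stacked_shifted_level_mat_def
  by (intro carrier_append_rows3 level_mat_carrier)+

lemma append_rows3_mult_vec:
  assumes "A1 \<in> carrier_mat d n" "A2 \<in> carrier_mat d n" "A3 \<in> carrier_mat d n" "v \<in> carrier_vec n"
  shows "(A1 @\<^sub>r A2 @\<^sub>r A3) *\<^sub>v v = (A1 *\<^sub>v v) @\<^sub>v (A2 *\<^sub>v v) @\<^sub>v (A3 *\<^sub>v v)"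
  using assms by (subst mat_mult_append[of _ d n _ "d + d"]; simp add: mat_mult_append[of _ d n _ d])

lemma append_vec3_add:
  assumes "u1 \<in> carrier_vec d" "u2 \<in> carrier_vec d" "u3 \<in> carrier_vec d"
    "v1 \<in> carrier_vec d" "v2 \<in> carrier_vec d" "v3 \<in> carrier_vec d"
  shows "(u1 @\<^sub>v u2 @\<^sub>v u3) + (v1 @\<^sub>v v2 @\<^sub>v v3) = (u1 + v1) @\<^sub>v (u2 + v2) @\<^sub>v (u3 + v3 :: real vec)"
  using assms by (intro eq_vecI) auto

lemma stacked_recurrence:
  assumes "\<alpha> \<in> {-1..} \<times> {-1..} \<times> {-1..} \<times> {-1..}" and "x \<in> ref_tetrahedron"
  shows "stacked_level_mat \<alpha> m (-1) (Suc (Suc m)) *\<^sub>v koorn_vec \<alpha> (int m + 1) x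
      + stacked_shifted_level_mat \<alpha> m x *\<^sub>v koorn_vec \<alpha> (int m) x
      + stacked_level_mat \<alpha> m 1 m *\<^sub>v koorn_vec \<alpha> (int m - 1) x = 0\<^sub>v (3 * block_offset (Suc m) (Suc m))"
proof -
  let ?r = "block_offset (Suc m) (Suc m)"
  have u: "koorn_vec \<alpha> (int m + 1) x \<in> carrier_vec (block_offset (Suc (Suc m)) (Suc (Suc m)))"
    using koorn_vec_carrier[of \<alpha> "Suc (Suc m)" x] by (simp add: add.commute)
  have v: "koorn_vec \<alpha> (int m) x \<in> carrier_vec ?r"
    using koorn_vec_carrier[of \<alpha> "Suc m" x] by simp
  have zero: "0\<^sub>v ?r @\<^sub>v 0\<^sub>v ?r @\<^sub>v 0\<^sub>v ?r = (0\<^sub>v (3 * ?r) :: real vec)"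
    by (intro eq_vecI) auto
  show ?thesis
    unfolding stacked_level_mat_def stacked_shifted_level_mat_def zero[symmetric]
    by (simp only: append_rows3_mult_vec[OF level_mat_carrier(1,1,1) u]
        append_rows3_mult_vec[OF level_mat_carrier(2,2,2) v]
        append_rows3_mult_vec[OF level_mat_carrier(1,1,1) koorn_vec_carrier]
        append_vec3_add[of _ ?r] mult_mat_vec_carrier[OF level_mat_carrier(1) u]
        mult_mat_vec_carrier[OF level_mat_carrier(2) v]
        mult_mat_vec_carrier[OF level_mat_carrier(1) koorn_vec_carrier] add_carrier_vec
        level_recurrence[OF assms])
qed

lemma stacked_level_mat_A_form: "A_form m (stacked_level_mat \<alpha> m (-1) (Suc (Suc m)))"
proof -
  define n where "n = Suc (Suc m)"
  define blk where "blk i = block (Suc m) n (level_mat i \<alpha> m (-1) n)" for i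
  have n: "m + 2 = n" "m + 1 = Suc m" by (simp_all add: n_def)
  have carrier: "blk i k j \<in> carrier_mat (Suc m - k) (n - j)" for i k j
    unfolding blk_def by (rule block_carrier)
  show ?thesis
    unfolding A_form_def koorn_dim_level stacked_level_mat_def n_def[symmetric] n
  proof (intro exI conjI)
    show "level_mat 1 \<alpha> m (-1) n @\<^sub>r level_mat 2 \<alpha> m (-1) n @\<^sub>r level_mat 3 \<alpha> m (-1) n
      = level_mat 1 \<alpha> m (-1) n @\<^sub>r level_mat 2 \<alpha> m (-1) n @\<^sub>r level_mat 3 \<alpha> m (-1) n" ..
    show "block_tridiagonal_form (Suc m) n (\<lambda>k. blk 1 k (k - 1)) ((\<lambda>i k. blk i k k) 1) (\<lambda>k. blk 1 k (Suc k))
        (level_mat 1 \<alpha> m (-1) n)"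
      unfolding blk_def by (rule level_mat_form)
    show "block_diagonal_form (Suc m) n ((\<lambda>i k. blk i k k) 2) (level_mat 2 \<alpha> m (-1) n)"
      "block_diagonal_form (Suc m) n ((\<lambda>i k. blk i k k) 3) (level_mat 3 \<alpha> m (-1) n)"
      unfolding blk_def by (rule level_mat_form; simp)+
    show "\<forall>k\<le>m. \<forall>i\<in>{1, 2, 3}. blk i k k \<in> carrier_mat (Suc m - k) (n - k)"
      using carrier by blast
    show "\<forall>k\<le>m. tridiagonal (blk 1 k k) \<and> tridiagonal (blk 2 k k) \<and> diagonal_mat (blk 3 k k)"
      unfolding blk_def by (auto simp: n_def intro!: level_mat_block_bands)
    show "\<forall>k\<le>m. blk 1 k (Suc k) \<in> carrier_mat (Suc m - k) (Suc m - k) \<and> lower_tridiagonal (blk 1 k (Suc k))"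
      using carrier[of 1 _ "Suc _"] unfolding blk_def by (auto simp: n_def intro!: level_mat_block_bands)
    show "\<forall>k\<in>{1..m}. blk 1 k (k - 1) \<in> carrier_mat (Suc m - k) (m + 3 - k) \<and> upper_tridiagonal (blk 1 k (k - 1))"
    proof (intro ballI conjI)
      fix k assume k: "k \<in> {1..m}"
      then have "n - (k - 1) = m + 3 - k" by (auto simp: n_def)
      then show "blk 1 k (k - 1) \<in> carrier_mat (Suc m - k) (m + 3 - k)" using carrier[of 1 k "k - 1"] by simp
      show "upper_tridiagonal (blk 1 k (k - 1))"
        unfolding blk_def using k by (intro level_mat_block_bands) (auto simp: n_def)
    qed
  qed simp_all
qed


lemma stacked_shifted_level_mat_B_form: "B_form m (stacked_shifted_level_mat \<alpha> m)"
proof -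
  define blk where "blk i = block (Suc m) (Suc m) (level_mat i \<alpha> m 0 (Suc m))" for i
  have n: "m + 1 = Suc m" by simp
  have carrier: "blk i k j \<in> carrier_mat (Suc m - k) (Suc m - j)" for i k j
    unfolding blk_def by (rule block_carrier)
  show ?thesis
    unfolding B_form_def koorn_dim_level n
  proof (intro exI conjI allI)
    fix x1 x2 x3 :: real
    show "stacked_shifted_level_mat \<alpha> m (x1, x2, x3) = shifted_level_mat 1 \<alpha> m x1
        @\<^sub>r shifted_level_mat 2 \<alpha> m x2 @\<^sub>r shifted_level_mat 3 \<alpha> m x3"
      by (simp add: stacked_shifted_level_mat_def)
    show "block_tridiagonal_form (Suc m) (Suc m) (\<lambda>k. blk 1 k (k - 1))
        (\<lambda>k. (\<lambda>i k. blk i k k) 1 k - x1 \<cdot>\<^sub>m 1\<^sub>m (Suc m - k)) (\<lambda>k. blk 1 k (Suc k)) (shifted_level_mat 1 \<alpha> m x1)"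
      unfolding blk_def by (rule shifted_level_mat_form)
    show "block_diagonal_form (Suc m) (Suc m) (\<lambda>k. (\<lambda>i k. blk i k k) 2 k - x2 \<cdot>\<^sub>m 1\<^sub>m (Suc m - k))
        (shifted_level_mat 2 \<alpha> m x2)"
      "block_diagonal_form (Suc m) (Suc m) (\<lambda>k. (\<lambda>i k. blk i k k) 3 k - x3 \<cdot>\<^sub>m 1\<^sub>m (Suc m - k))
        (shifted_level_mat 3 \<alpha> m x3)"
      unfolding blk_def by (rule shifted_level_mat_form; simp)+
  next
    fix k
    show "k \<le> m \<longrightarrow> (\<forall>i\<in>{1, 2, 3}. blk i k k \<in> carrier_mat (Suc m - k) (Suc m - k))"
      using carrier by blast
    show "k \<le> m \<longrightarrow> tridiagonal (blk 1 k k) \<and> tridiagonal (blk 2 k k) \<and> diagonal_mat (blk 3 k k)"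
      unfolding blk_def by (auto intro!: level_mat_block_bands)
    show "k < m \<longrightarrow> blk 1 k (Suc k) \<in> carrier_mat (Suc m - k) (m - k) \<and> lower_tridiagonal (blk 1 k (Suc k))"
      using carrier[of 1 k "Suc k"] unfolding blk_def by (auto intro!: level_mat_block_bands)
  next
    show "\<forall>k\<in>{1..m}. blk 1 k (k - 1) \<in> carrier_mat (Suc m - k) (m + 2 - k) \<and> upper_tridiagonal (blk 1 k (k - 1))"
    proof (intro ballI conjI)
      fix k assume k: "k \<in> {1..m}"
      then have "Suc m - (k - 1) = m + 2 - k" by auto
      then show "blk 1 k (k - 1) \<in> carrier_mat (Suc m - k) (m + 2 - k)" using carrier[of 1 k "k - 1"] by simp
      show "upper_tridiagonal (blk 1 k (k - 1))"
        unfolding blk_def using k by (intro level_mat_block_bands) auto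
    qed
  qed simp_all
qed

lemma stacked_level_mat_C_form: "C_form m (stacked_level_mat \<alpha> m 1 m)"
proof -
  define blk where "blk i = block (Suc m) m (level_mat i \<alpha> m 1 m)" for i
  have n: "m + 1 = Suc m" by simp
  have carrier: "blk i k j \<in> carrier_mat (Suc m - k) (m - j)" for i k j
    unfolding blk_def by (rule block_carrier)
  show ?thesis
    unfolding C_form_def koorn_dim_level stacked_level_mat_def n
  proof (intro exI conjI)
    show "level_mat 1 \<alpha> m 1 m @\<^sub>r level_mat 2 \<alpha> m 1 m @\<^sub>r level_mat 3 \<alpha> m 1 m
      = level_mat 1 \<alpha> m 1 m @\<^sub>r level_mat 2 \<alpha> m 1 m @\<^sub>r level_mat 3 \<alpha> m 1 m" ..
    show "block_tridiagonal_form (Suc m) m (\<lambda>k. blk 1 k (k - 1)) ((\<lambda>i k. blk i k k) 1) (\<lambda>k. blk 1 k (Suc k))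
        (level_mat 1 \<alpha> m 1 m)"
      unfolding blk_def by (rule level_mat_form)
    show "block_diagonal_form (Suc m) m ((\<lambda>i k. blk i k k) 2) (level_mat 2 \<alpha> m 1 m)"
      "block_diagonal_form (Suc m) m ((\<lambda>i k. blk i k k) 3) (level_mat 3 \<alpha> m 1 m)"
      unfolding blk_def by (rule level_mat_form; simp)+
    show "\<forall>k<m. \<forall>i\<in>{1, 2, 3}. blk i k k \<in> carrier_mat (Suc m - k) (m - k)"
      using carrier by blast
    show "\<forall>k<m. tridiagonal (blk 1 k k) \<and> tridiagonal (blk 2 k k) \<and> diagonal_mat (blk 3 k k)"
      unfolding blk_def by (auto intro!: level_mat_block_bands)
    show "\<forall>k. k + 2 \<le> m \<longrightarrow> blk 1 k (Suc k) \<in> carrier_mat (Suc m - k) (m - k - 1) \<and> lower_tridiagonal (blk 1 k (Suc k))"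
      using carrier[of 1 _ "Suc _"] unfolding blk_def by (auto intro!: level_mat_block_bands)
    show "\<forall>k\<in>{1..m}. blk 1 k (k - 1) \<in> carrier_mat (Suc m - k) (Suc m - k) \<and> upper_tridiagonal (blk 1 k (k - 1))"
    proof (intro ballI conjI)
      fix k assume k: "k \<in> {1..m}"
      then have "m - (k - 1) = Suc m - k" by auto
      then show "blk 1 k (k - 1) \<in> carrier_mat (Suc m - k) (Suc m - k)" using carrier[of 1 k "k - 1"] by simp
      show "upper_tridiagonal (blk 1 k (k - 1))"
        unfolding blk_def using k by (intro level_mat_block_bands) auto
    qed
  qed simp_all
qed

section \<open>Uniqueness\<close>
lemma index_append_rows3:
  assumes "A1 \<in> carrier_mat d n" "A2 \<in> carrier_mat d n" "A3 \<in> carrier_mat d n" "i < 3 * d" "j < n"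
  shows "(A1 @\<^sub>r A2 @\<^sub>r A3) $$ (i, j) =
    (if i < d then A1 $$ (i, j) else if i < 2 * d then A2 $$ (i - d, j) else A3 $$ (i - 2 * d, j))"
  using assms by (auto simp: append_rows_def numeral_2_eq_2 diff_diff_left)

text \<open>Since the flattening is injective, the diagonals of the diagonal blocks make up exactly the diagonal
  of the whole matrix.\<close>
lemma index_mat_shifted_blocks:
  assumes "\<And>k j. k < n \<Longrightarrow> j < n \<Longrightarrow> block n n M k j = (if j = k then V k - s \<cdot>\<^sub>m 1\<^sub>m (n - k) else T k j)"
    and "\<And>k j. k < n \<Longrightarrow> j < n \<Longrightarrow> block n n M' k j = (if j = k then V k - 0 \<cdot>\<^sub>m 1\<^sub>m (n - k) else T k j)"
    and "\<And>k. k < n \<Longrightarrow> V k \<in> carrier_mat (n - k) (n - k)"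
    and "i < block_offset n n" "i' < block_offset n n"
  shows "M $$ (i, i') = M' $$ (i, i') - (if i = i' then s else 0 :: real)"
proof -
  obtain k a where ka: "k < n" "a < n - k" and i: "i = flat_index n (k, a)"
    using assms(4) by (rule flat_index_surj)
  obtain j b where jb: "j < n" "b < n - j" and i': "i' = flat_index n (j, b)"
    using assms(5) by (rule flat_index_surj)
  have "flat_index n (k, a) = flat_index n (j, b) \<longleftrightarrow> (k, a) = (j, b)"
    using ka jb by (intro inj_on_eq_iff[OF inj_on_flat_index]) (auto simp: block_positions_def)
  then show ?thesis
    unfolding i i' index_mat_eq_index_block[OF ka(2) jb(2)] assms(1)[OF ka(1) jb(1)] assms(2)[OF ka(1) jb(1)]
    using ka jb assms(3)[of k] by auto
qed

text \<open>The blocks are chosen before the point, so the values of \<open>B\<close> at any two points differ by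
  a known matrix. Thus \<open>B\<close> is determined by its value at the origin, even outside
  the tetrahedron.\<close>
lemma B_form_entry:
  assumes "B_form m B" "i < 3 * block_offset (Suc m) (Suc m)" "j < block_offset (Suc m) (Suc m)"
  shows "B (x1, x2, x3) $$ (i, j) = B (0, 0, 0) $$ (i, j)
    - (if i = j then x1 else if i = block_offset (Suc m) (Suc m) + j then x2
       else if i = 2 * block_offset (Suc m) (Suc m) + j then x3 else 0)"
proof -
  define d where "d = block_offset (Suc m) (Suc m)"
  have n: "m + 1 = Suc m" by simp
  obtain V W U where "\<forall>k\<le>m. \<forall>i\<in>{1,2,3::nat}. V i k \<in> carrier_mat (Suc m - k) (Suc m - k)"
    and "\<forall>x1 x2 x3. \<exists>B1 B2 B3.
        B1 \<in> carrier_mat d d \<and> B2 \<in> carrier_mat d d \<and> B3 \<in> carrier_mat d d \<and>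
        B (x1, x2, x3) = B1 @\<^sub>r B2 @\<^sub>r B3 \<and>
        block_tridiagonal_form (Suc m) (Suc m) U (\<lambda>k. V 1 k - x1 \<cdot>\<^sub>m 1\<^sub>m (Suc m - k)) W B1 \<and>
        block_diagonal_form (Suc m) (Suc m) (\<lambda>k. V 2 k - x2 \<cdot>\<^sub>m 1\<^sub>m (Suc m - k)) B2 \<and>
        block_diagonal_form (Suc m) (Suc m) (\<lambda>k. V 3 k - x3 \<cdot>\<^sub>m 1\<^sub>m (Suc m - k)) B3"
    using assms(1)[unfolded B_form_def koorn_dim_level n d_def[symmetric]]
    by (elim exE conjE) (rule that; assumption)
  then have V: "\<And>k i. k \<le> m \<Longrightarrow> i \<in> {1,2,3::nat} \<Longrightarrow> V i k \<in> carrier_mat (Suc m - k) (Suc m - k)"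
    and forms: "\<And>x1 x2 x3. \<exists>B1 B2 B3.
        B1 \<in> carrier_mat d d \<and> B2 \<in> carrier_mat d d \<and> B3 \<in> carrier_mat d d \<and>
        B (x1, x2, x3) = B1 @\<^sub>r B2 @\<^sub>r B3 \<and>
        block_tridiagonal_form (Suc m) (Suc m) U (\<lambda>k. V 1 k - x1 \<cdot>\<^sub>m 1\<^sub>m (Suc m - k)) W B1 \<and>
        block_diagonal_form (Suc m) (Suc m) (\<lambda>k. V 2 k - x2 \<cdot>\<^sub>m 1\<^sub>m (Suc m - k)) B2 \<and>
        block_diagonal_form (Suc m) (Suc m) (\<lambda>k. V 3 k - x3 \<cdot>\<^sub>m 1\<^sub>m (Suc m - k)) B3"
    by blast+
  from forms[of x1 x2 x3] obtain B1 B2 B3 where B: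
    "B1 \<in> carrier_mat d d" "B2 \<in> carrier_mat d d" "B3 \<in> carrier_mat d d" "B (x1, x2, x3) = B1 @\<^sub>r B2 @\<^sub>r B3"
    "block_tridiagonal_form (Suc m) (Suc m) U (\<lambda>k. V 1 k - x1 \<cdot>\<^sub>m 1\<^sub>m (Suc m - k)) W B1"
    "block_diagonal_form (Suc m) (Suc m) (\<lambda>k. V 2 k - x2 \<cdot>\<^sub>m 1\<^sub>m (Suc m - k)) B2"
    "block_diagonal_form (Suc m) (Suc m) (\<lambda>k. V 3 k - x3 \<cdot>\<^sub>m 1\<^sub>m (Suc m - k)) B3"
    by blast
  from forms[of 0 0 0] obtain D1 D2 D3 where D:
    "D1 \<in> carrier_mat d d" "D2 \<in> carrier_mat d d" "D3 \<in> carrier_mat d d" "B (0, 0, 0) = D1 @\<^sub>r D2 @\<^sub>r D3"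
    "block_tridiagonal_form (Suc m) (Suc m) U (\<lambda>k. V 1 k - 0 \<cdot>\<^sub>m 1\<^sub>m (Suc m - k)) W D1"
    "block_diagonal_form (Suc m) (Suc m) (\<lambda>k. V 2 k - 0 \<cdot>\<^sub>m 1\<^sub>m (Suc m - k)) D2"
    "block_diagonal_form (Suc m) (Suc m) (\<lambda>k. V 3 k - 0 \<cdot>\<^sub>m 1\<^sub>m (Suc m - k)) D3"
    by blast
  have 1: "B1 $$ (i, j) = D1 $$ (i, j) - (if i = j then x1 else 0)" if "i < d" "j < d" for i j
    using B(5) D(5) that unfolding block_tridiagonal_form_def d_def
    by (intro index_mat_shifted_blocks[where V = "V 1" and n = "Suc m"
          and T = "\<lambda>k j. if j = k + 1 then W k else if k = j + 1 then U k else 0\<^sub>m (Suc m - k) (Suc m - j)"])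
      (auto intro!: V)
  have diag: "M $$ (i, j) = M' $$ (i, j) - (if i = j then s else 0)"
    if "block_diagonal_form (Suc m) (Suc m) (\<lambda>k. V c k - s \<cdot>\<^sub>m 1\<^sub>m (Suc m - k)) M"
      "block_diagonal_form (Suc m) (Suc m) (\<lambda>k. V c k - 0 \<cdot>\<^sub>m 1\<^sub>m (Suc m - k)) M'"
      "i < d" "j < d" "c \<in> {1, 2, 3}" for M M' s c i j
    using that unfolding block_diagonal_form_def d_def
    by (intro index_mat_shifted_blocks[where V = "V c" and n = "Suc m"
          and T = "\<lambda>k j. 0\<^sub>m (Suc m - k) (Suc m - j)"]) (simp_all add: V)
  have "i < 3 * d" "j < d" using assms(2,3) by (simp_all add: d_def)
  then show ?thesis
    unfolding B(4) D(4) d_def[symmetric] index_append_rows3[OF B(1-3) \<open>i < 3 * d\<close> \<open>j < d\<close>]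
      index_append_rows3[OF D(1-3) \<open>i < 3 * d\<close> \<open>j < d\<close>]
    using 1[of i j] diag[OF B(6) D(6), of "i - d" j] diag[OF B(7) D(7), of "i - 2 * d" j] by auto
qed

text \<open>Distinct levels contain polynomials of distinct total degree, so several vectors taken
  together are still a family of distinct Koornwinder polynomials; \<open>(j, b, e)\<close> belongs to level
  \<open>j + b + e + 1\<close>.\<close>
lemma koorn_vecs_independent:
  assumes \<alpha>: "\<alpha> \<in> {-1..} \<times> {-1..} \<times> {-1..} \<times> {-1..}"
    and "finite N"
    and zero: "\<And>x. x \<in> ref_tetrahedron \<Longrightarrow>
      (\<Sum>n\<in>N. \<Sum>\<sigma>\<in>block_positions n. c n \<sigma> * koorn_vec \<alpha> (int n - 1) x $ flat_index n \<sigma>) = 0"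
    and "n \<in> N" "\<sigma> \<in> block_positions n"
  shows "c n \<sigma> = 0"
proof -
  let ?P = "SIGMA n:N. block_positions n"
  let ?l = "\<lambda>(n, j, b). (j, b, n - 1 - j - b)"
  let ?c = "\<lambda>(j, b, e). c (j + b + e + 1) (j, b)"
  have inj: "inj_on ?l ?P"
    by (auto simp: inj_on_def block_positions_def)
  have "?c (?l (n, \<sigma>)) = 0"
  proof (rule koornwinder_independent[OF \<alpha>, where S = "?l ` ?P" and c = ?c])
    show "finite (?l ` ?P)" using \<open>finite N\<close> by simp
    show "?l (n, \<sigma>) \<in> ?l ` ?P" using assms(4,5) by blast
    fix x assume x: "x \<in> ref_tetrahedron"
    have "(\<Sum>(l1, l2, l3)\<in>?l ` ?P. ?c (l1, l2, l3) * koornwinder \<alpha> (int l1, int l2, int l3) x)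
      = (\<Sum>(n, \<sigma>)\<in>?P. c n \<sigma> * koorn_vec \<alpha> (int n - 1) x $ flat_index n \<sigma>)"
      unfolding sum.reindex[OF inj]
    proof (intro sum.cong refl)
      fix \<tau> assume \<tau>: "\<tau> \<in> ?P"
      obtain n j b where njb: "\<tau> = (n, j, b)" by (rule prod_cases3)
      have jb: "(j, b) \<in> block_positions n" using \<tau> by (simp add: njb)
      then have e: "j + b + (n - 1 - j - b) + 1 = n" and e': "int (n - 1 - j - b) = int n - 1 - int j - int b"
        by (auto simp: block_positions_def)
      show "((\<lambda>(l1, l2, l3). ?c (l1, l2, l3) * koornwinder \<alpha> (int l1, int l2, int l3) x) \<circ> ?l) \<tau>
          = (case \<tau> of (n, \<sigma>) \<Rightarrow> c n \<sigma> * koorn_vec \<alpha> (int n - 1) x $ flat_index n \<sigma>)"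
        unfolding njb koorn_vec_nth[OF jb] comp_def case_prod_conv e e' ..
    qed
    also have "\<dots> = 0"
      using zero[OF x] \<open>finite N\<close> by (simp add: sum.Sigma)
    finally show "(\<Sum>(l1, l2, l3)\<in>?l ` ?P. ?c (l1, l2, l3) * koornwinder \<alpha> (int l1, int l2, int l3) x) = 0" .
  qed
  moreover obtain j b where "\<sigma> = (j, b)" by (cases \<sigma>)
  ultimately show ?thesis using assms(5) by (auto simp: block_positions_def)
qed


lemma stacked_recurrence_row:
  fixes m :: nat
  assumes A: "A \<in> carrier_mat (3 * koorn_dim m) (koorn_dim (int m + 1))"
    and B: "B \<in> carrier_mat (3 * koorn_dim m) (koorn_dim m)"
    and C: "C \<in> carrier_mat (3 * koorn_dim m) (koorn_dim (int m - 1))"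
    and eq: "A *\<^sub>v koorn_vec \<alpha> (int m + 1) x + B *\<^sub>v koorn_vec \<alpha> m x + C *\<^sub>v koorn_vec \<alpha> (int m - 1) x
      = 0\<^sub>v (3 * koorn_dim m)"
    and i: "i < 3 * koorn_dim m"
  defines "entry \<equiv> \<lambda>n M. \<Sum>\<sigma>\<in>block_positions n. M $$ (i, flat_index n \<sigma>) * koorn_vec \<alpha> (int n - 1) x $ flat_index n \<sigma>"
  shows "entry (Suc (Suc m)) A + entry (Suc m) B + entry m C = 0"
proof -
  have entry: "entry n M = (M *\<^sub>v koorn_vec \<alpha> (int n - 1) x) $ i"
    if "M \<in> carrier_mat (3 * koorn_dim m) (block_offset n n)" for n M
    unfolding entry_def using that i by (intro mult_mat_vec_block_positions[symmetric] dim_koorn_vec) auto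
  have "entry (Suc (Suc m)) A + entry (Suc m) B + entry m C
      = (A *\<^sub>v koorn_vec \<alpha> (int m + 1) x + B *\<^sub>v koorn_vec \<alpha> m x + C *\<^sub>v koorn_vec \<alpha> (int m - 1) x) $ i"
    using entry[of A "Suc (Suc m)"] entry[of B "Suc m"] entry[of C m] A[unfolded koorn_dim_level(2)] B C i
    by (simp add: koorn_dim_level add.commute)
  then show ?thesis using i by (simp add: eq)
qed

lemma mat_eq_by_block_positions:
  assumes "M \<in> carrier_mat d (block_offset n n)" "M' \<in> carrier_mat d (block_offset n n)"
    and "\<And>i \<sigma>. i < d \<Longrightarrow> \<sigma> \<in> block_positions n \<Longrightarrow> M $$ (i, flat_index n \<sigma>) = M' $$ (i, flat_index n \<sigma>)"
  shows "M = M'"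
proof (rule eq_matI)
  fix i j assume "i < dim_row M'" "j < dim_col M'"
  then have "i < d" "j < block_offset n n" using assms(2) by auto
  moreover obtain k a where "k < n" "a < n - k" "j = flat_index n (k, a)"
    using \<open>j < block_offset n n\<close> by (rule flat_index_surj)
  ultimately show "M $$ (i, j) = M' $$ (i, j)"
    using assms(3) by (simp add: block_positions_def)
qed (use assms in auto)

text \<open>The difference of two solutions gives, in each row, a linear relation between Koornwinder
  polynomials of degrees \<open>m + 1\<close>, \<open>m\<close> and \<open>m - 1\<close>. Its coefficients are constants, since the parts of the two
  middle matrices that depend on the point cancel.\<close>
lemma stacked_recurrence_unique:
  fixes m :: nat
  assumes \<alpha>: "\<alpha> \<in> {-1..} \<times> {-1..} \<times> {-1..} \<times> {-1..}"
    and A: "A \<in> carrier_mat (3 * koorn_dim m) (koorn_dim (int m + 1))"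
      "A' \<in> carrier_mat (3 * koorn_dim m) (koorn_dim (int m + 1))"
    and B: "\<And>x. B x \<in> carrier_mat (3 * koorn_dim m) (koorn_dim m)"
      "\<And>x. B' x \<in> carrier_mat (3 * koorn_dim m) (koorn_dim m)"
    and C: "C \<in> carrier_mat (3 * koorn_dim m) (koorn_dim (int m - 1))"
      "C' \<in> carrier_mat (3 * koorn_dim m) (koorn_dim (int m - 1))"
    and form: "B_form m B" "B_form m B'"
    and eq: "\<And>x. x \<in> ref_tetrahedron \<Longrightarrow>
      A *\<^sub>v koorn_vec \<alpha> (int m + 1) x + B x *\<^sub>v koorn_vec \<alpha> m x + C *\<^sub>v koorn_vec \<alpha> (int m - 1) x
        = 0\<^sub>v (3 * koorn_dim m)"
      "\<And>x. x \<in> ref_tetrahedron \<Longrightarrow>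
      A' *\<^sub>v koorn_vec \<alpha> (int m + 1) x + B' x *\<^sub>v koorn_vec \<alpha> m x + C' *\<^sub>v koorn_vec \<alpha> (int m - 1) x
        = 0\<^sub>v (3 * koorn_dim m)"
  shows "A = A' \<and> B = B' \<and> C = C'"
proof -
  let ?d = "3 * koorn_dim m"
  have B_diff: "B x $$ (i, j) - B' x $$ (i, j) = B (0, 0, 0) $$ (i, j) - B' (0, 0, 0) $$ (i, j)"
    if "i < ?d" "j < koorn_dim m" for x i j
  proof -
    obtain x1 x2 x3 where x: "x = (x1, x2, x3)" by (rule prod_cases3)
    show ?thesis
      using that B_form_entry[OF form(1), of i j x1 x2 x3] B_form_entry[OF form(2), of i j x1 x2 x3]
      by (simp add: x koorn_dim_level)
  qed
  define D where "D n = (if n = Suc (Suc m) then A else if n = Suc m then B (0, 0, 0) else C)" for n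
  define D' where "D' n = (if n = Suc (Suc m) then A' else if n = Suc m then B' (0, 0, 0) else C')" for n
  have D: "D n $$ (i, flat_index n \<sigma>) = D' n $$ (i, flat_index n \<sigma>)"
    if i: "i < ?d" and n: "n \<in> {m, Suc m, Suc (Suc m)}" "\<sigma> \<in> block_positions n" for n i \<sigma>
  proof -
    have "D n $$ (i, flat_index n \<sigma>) - D' n $$ (i, flat_index n \<sigma>) = 0"
    proof (rule koorn_vecs_independent[OF \<alpha> _ _ n, where
          c = "\<lambda>n \<sigma>. D n $$ (i, flat_index n \<sigma>) - D' n $$ (i, flat_index n \<sigma>)"])
      fix x assume x: "x \<in> ref_tetrahedron"
      let ?row = "\<lambda>n M. \<Sum>\<sigma>\<in>block_positions n.
        M $$ (i, flat_index n \<sigma>) * koorn_vec \<alpha> (int n - 1) x $ flat_index n \<sigma>"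
      have rows: "?row (Suc (Suc m)) A + ?row (Suc m) (B x) + ?row m C = 0"
        "?row (Suc (Suc m)) A' + ?row (Suc m) (B' x) + ?row m C' = 0"
        using stacked_recurrence_row[OF A(1) B(1) C(1) eq(1)[OF x] i]
          stacked_recurrence_row[OF A(2) B(2) C(2) eq(2)[OF x] i] .
      have diff: "(\<Sum>\<sigma>\<in>block_positions n. (M $$ (i, flat_index n \<sigma>) - M' $$ (i, flat_index n \<sigma>))
          * koorn_vec \<alpha> (int n - 1) x $ flat_index n \<sigma>) = ?row n M - ?row n M'" for n M M'
        by (simp only: left_diff_distrib sum_subtractf)
      have "(\<Sum>\<sigma>\<in>block_positions (Suc m).
          (B (0, 0, 0) $$ (i, flat_index (Suc m) \<sigma>) - B' (0, 0, 0) $$ (i, flat_index (Suc m) \<sigma>))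
          * koorn_vec \<alpha> (int (Suc m) - 1) x $ flat_index (Suc m) \<sigma>)
        = ?row (Suc m) (B x) - ?row (Suc m) (B' x)"
        unfolding diff[symmetric]
      proof (intro sum.cong refl arg_cong2[where f = times] B_diff[symmetric] i)
        fix \<sigma> assume "\<sigma> \<in> block_positions (Suc m)"
        then show "flat_index (Suc m) \<sigma> < koorn_dim m"
          unfolding koorn_dim_level using bij_betwE[OF bij_betw_flat_index] by blast
      qed
      then show "(\<Sum>n\<in>{m, Suc m, Suc (Suc m)}. \<Sum>\<sigma>\<in>block_positions n.
          (D n $$ (i, flat_index n \<sigma>) - D' n $$ (i, flat_index n \<sigma>))
          * koorn_vec \<alpha> (int n - 1) x $ flat_index n \<sigma>) = 0"
        using rows diff[where n = "Suc (Suc m)" and M = A and M' = A'] diff[where n = m and M = C and M' = C'] by (simp add: D_def D'_def)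
    qed simp
    then show ?thesis by simp
  qed
  have "A = A'"
    using A D[of _ "Suc (Suc m)"] unfolding koorn_dim_level(2)
    by (intro mat_eq_by_block_positions) (auto simp: D_def D'_def)
  moreover have "C = C'"
    using C D[of _ m] unfolding koorn_dim_level(3)
    by (intro mat_eq_by_block_positions) (auto simp: D_def D'_def)
  moreover have "B (0, 0, 0) = B' (0, 0, 0)"
    using B D[of _ "Suc m"] unfolding koorn_dim_level(1)
    by (intro mat_eq_by_block_positions) (auto simp: D_def D'_def)
  moreover have "B x = B' x" for x
  proof (rule eq_matI)
    fix i j assume "i < dim_row (B' x)" "j < dim_col (B' x)"
    then have "i < ?d" "j < koorn_dim m" using B(2)[of x] by auto
    from B_diff[OF this, of x] show "B x $$ (i, j) = B' x $$ (i, j)"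
      using \<open>B (0, 0, 0) = B' (0, 0, 0)\<close> by simp
  qed (use B[of x] in auto)
  ultimately show ?thesis by auto
qed

theorem theorem2p1:
  fixes \<alpha> :: param
  assumes "\<alpha> \<in> {-1..} \<times> {-1..} \<times> {-1..} \<times> {-1..}"
  shows
    "(\<forall>l \<in> {0..} \<times> {0..} \<times> {0..}. \<forall>x1 x2 x3. (x1, x2, x3) \<in> ref_tetrahedron \<longrightarrow>
        x1 * koornwinder \<alpha> l (x1, x2, x3) =
          (\<Sum>p=-1..1. \<Sum>q=-1..1. \<Sum>r=-1..1.
            koorn_C3 l \<alpha> p q r * koornwinder \<alpha> (l - (p, q - p, r - q)) (x1, x2, x3)) \<and>
        x2 * koornwinder \<alpha> l (x1, x2, x3) =
          (\<Sum>q=-1..1. \<Sum>r=-1..1.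
            koorn_C2 l \<alpha> q r * koornwinder \<alpha> (l - (0, q, r - q)) (x1, x2, x3)) \<and>
        x3 * koornwinder \<alpha> l (x1, x2, x3) =
          (\<Sum>r=-1..1. koorn_C1 l \<alpha> r * koornwinder \<alpha> (l - (0, 0, r)) (x1, x2, x3)))
     \<and>
     (\<forall>m::nat. \<exists>!(M :: real mat \<times> (point \<Rightarrow> real mat) \<times> real mat). case M of (A, B, C) \<Rightarrow>
        A \<in> carrier_mat (3 * koorn_dim m) (koorn_dim (int m + 1)) \<and>
        (\<forall>x. B x \<in> carrier_mat (3 * koorn_dim m) (koorn_dim m)) \<and>
        C \<in> carrier_mat (3 * koorn_dim m) (koorn_dim (int m - 1)) \<and>
        A_form m A \<and> B_form m B \<and> C_form m C \<and>
        (\<forall>x \<in> ref_tetrahedron.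
           A *\<^sub>v koorn_vec \<alpha> (int m + 1) x + B x *\<^sub>v koorn_vec \<alpha> m x
             + C *\<^sub>v koorn_vec \<alpha> (int m - 1) x = 0\<^sub>v (3 * koorn_dim m)))"
proof (intro conjI ballI allI impI, goal_cases)
  case (1 l x1 x2 x3)
  then show ?case
    using koornwinder_mult_coord[OF assms, of l "(x1, x2, x3)" 1]
    by (simp only: koorn_coeff_def coord.simps if_True simp_thms)
next
  case (2 l x1 x2 x3)
  then show ?case
    using koornwinder_mult_coord[OF assms, of l "(x1, x2, x3)" 2]
    by (simp add: koorn_coeff_def sum_neg1_to_1)
next
  case (3 l x1 x2 x3)
  then show ?case
    using koornwinder_mult_coord[OF assms, of l "(x1, x2, x3)" 3]
    by (simp add: koorn_coeff_def sum_neg1_to_1)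
next
  case (4 m)
  let ?M = "(stacked_level_mat \<alpha> m (-1) (Suc (Suc m)), stacked_shifted_level_mat \<alpha> m, stacked_level_mat \<alpha> m 1 m)"
  show ?case
  proof (rule ex1I[of _ ?M], goal_cases)
    case 1
    show ?case
      unfolding case_prod_conv koorn_dim_level
      using stacked_carrier stacked_level_mat_A_form stacked_shifted_level_mat_B_form
        stacked_level_mat_C_form stacked_recurrence[OF assms] by blast
  next
    case (2 M)
    obtain A B C where M: "M = (A, B, C)" by (rule prod_cases3)
    show ?case
      unfolding M prod.inject using 2[unfolded M case_prod_conv]
      by (intro stacked_recurrence_unique[OF assms])
        (auto simp: koorn_dim_level stacked_carrier stacked_shifted_level_mat_B_form stacked_recurrence[OF assms])
  qed
qed

end
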